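(* Let $u$ be a harmonic function in the open upper half-plane $\mathbb{H}$ which is of temperate growth at infinity. Let $\tau=\frac{m}{n}\pi$ with $m,n$ relatively prime positive integers and $m<n$. Assume that (1)' $\lim_{y\to0+}u(\cdot+iy)=0$ in $\mathcal{D}'(\mathbb{R})$; (2) $\displaystyle\lim_{t\to+\infty}u(te^{i\tau})/t=0$; and (3) $\displaystyle\lim_{t\to+\infty}u(te^{i\theta})/t^n=0$ for some $0<\theta<\pi$ which is not a rational multiple of $\pi$. Then $u(z)=0$ for all $z\in\mathbb{H}$.
   Context: $\mathbb{H}=\{z\in\mathbb{C}:\operatorname{Im} z>0\}$ is the open upper half-plane. Harmonic functions are complex-valued $C^2$ functions annihilated by the usual Laplacian. A function $u$ in $\mathbb{H}$ is of temperate growth at infinity if there are positive constants $C,R,N$ such that $|u(z)|\leq C\,(|z|^2/\operatorname{Im} z)^N$ for all $z\in\mathbb{H}$ with $|z|>R$. $\lim_{y\to0+}u(\cdot+iy)=0$ in $\mathcal{D}'(\mathbb{R})$ means that $\lim_{y\to0+}\int_{-\infty}^\infty u(x+iy)\psi(x)\,dx=0$ for every $\psi\in C_0^\infty(\mathbb{R})$ (smooth compactly supported test functions). *)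

theory Defs
  imports "HOL-Analysis.Analysis"
begin

definition upper_half_plane :: "complex set" where
  "upper_half_plane = {z. Im z > 0}"

text \<open>The directions \<open>1\<close> and \<open>\<i>\<close> give the partial derivatives with respect to
  \<open>x = Re z\<close> and \<open>y = Im z\<close>; the scalar \<open>t\<close> is real.\<close>

definition has_dir_deriv :: "complex \<Rightarrow> (complex \<Rightarrow> complex) \<Rightarrow> complex \<Rightarrow> bool" where
  "has_dir_deriv v f z \<longleftrightarrow> (\<lambda>t::real. f (z + of_real t * v)) differentiable (at 0)"

definition dir_deriv :: "complex \<Rightarrow> (complex \<Rightarrow> complex) \<Rightarrow> complex \<Rightarrow> complex" where
  "dir_deriv v f z = vector_derivative (\<lambda>t::real. f (z + of_real t * v)) (at 0)"

text \<open>Real \<open>C\<^sup>1\<close> and \<open>C\<^sup>2\<close> regularity, intended for open \<open>S\<close>.\<close>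

definition C1_on :: "(complex \<Rightarrow> complex) \<Rightarrow> complex set \<Rightarrow> bool" where
  "C1_on f S \<longleftrightarrow>
     (\<forall>v\<in>{1, \<i>}. (\<forall>z\<in>S. has_dir_deriv v f z) \<and> continuous_on S (dir_deriv v f))"

definition C2_on :: "(complex \<Rightarrow> complex) \<Rightarrow> complex set \<Rightarrow> bool" where
  "C2_on f S \<longleftrightarrow> C1_on f S \<and> (\<forall>v\<in>{1, \<i>}. C1_on (dir_deriv v f) S)"

definition laplacian :: "(complex \<Rightarrow> complex) \<Rightarrow> complex \<Rightarrow> complex" where
  "laplacian f z = dir_deriv 1 (dir_deriv 1 f) z + dir_deriv \<i> (dir_deriv \<i> f) z"

definition harmonic_on :: "(complex \<Rightarrow> complex) \<Rightarrow> complex set \<Rightarrow> bool" where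
  "harmonic_on f S \<longleftrightarrow> C2_on f S \<and> (\<forall>z\<in>S. laplacian f z = 0)"

definition temperate_growth_at_infinity :: "(complex \<Rightarrow> complex) \<Rightarrow> bool" where
  "temperate_growth_at_infinity u \<longleftrightarrow>
     (\<exists>C R N :: real. C > 0 \<and> R > 0 \<and> N > 0 \<and>
        (\<forall>z\<in>upper_half_plane. norm z > R \<longrightarrow> norm (u z) \<le> C * ((norm z)\<^sup>2 / Im z) powr N))"

definition test_function :: "(real \<Rightarrow> complex) \<Rightarrow> bool" where
  "test_function \<psi> \<longleftrightarrow>
     (\<forall>k x. ((\<lambda>f t. vector_derivative f (at t)) ^^ k) \<psi> differentiable (at x)) \<and>
     compact (closure {x. \<psi> x \<noteq> 0})"

definition vanishing_distributional_boundary_values :: "(complex \<Rightarrow> complex) \<Rightarrow> bool" where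
  "vanishing_distributional_boundary_values u \<longleftrightarrow>
     (\<forall>\<psi>. test_function \<psi> \<longrightarrow>
        ((\<lambda>y. LINT x|lborel. u (Complex x y) * \<psi> x) \<longlongrightarrow> 0) (at_right 0))"

end

theory Submission
  imports Defs "HOL-Complex_Analysis.Complex_Analysis" "HOL-Real_Asymp.Real_Asymp"
begin

text \<open>A harmonic function on the half-plane is \<open>A(z) + B(cnj z)\<close> with \<open>A\<close> and \<open>B\<close> holomorphic.
  Convolving in the horizontal direction with a test function \<open>\<phi>\<close> keeps this form, and a
  gliding hump argument upgrades the vanishing of the distributional boundary values to local
  boundedness, near the real axis, of the mollified function and of its horizontal derivatives.
  Hence the mollified \<open>A\<close> and \<open>- B\<close> glue to an entire function \<open>P\<close>, and the mollified
  \<open>u\<close> is \<open>P(z) - P(cnj z)\<close>. Temperate growth makes \<open>P\<close> a polynomial of degree bounded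
  independently of \<open>\<phi>\<close>, so letting \<open>\<phi>\<close> tend to the Dirac measure shows
  \<open>u (r cis \<alpha>) = (\<Sum>k\<le>M. c k * 2 \<i> * sin (k \<alpha>) * r ^ k)\<close>. Decay along the irrational ray kills
  \<open>c k\<close> for \<open>k \<ge> n\<close>; decay along the ray \<open>m \<pi> / n\<close> kills \<open>c k\<close> for \<open>k \<ge> 1\<close> unless
  \<open>n\<close> divides \<open>k\<close>.\<close>

section \<open>Decomposition of harmonic functions on the upper half-plane\<close>

text \<open>Distributional boundary values give no pointwise control of \<open>u\<close> at the real
  axis, so gluing cannot be applied to \<open>u\<close> itself. After mollification the vertical
  limits are 0 at every real point, but locally uniform bounds are still missing. They express the
  uniform boundedness principle for the functionals that integrate \<open>u\<close> at height
  \<open>y\<close> against a test function, here realised by one explicit lacunary test function.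
  Such bounds control only the sum of the holomorphic and the antiholomorphic part; separating the
  two costs one derivative more, which is available because a horizontal derivative of a mollified
  function is again a mollified function. The degree bound survives the limit since a horizontal
  shift leaves \<open>Im z\<close> unchanged: it alters the constants in the growth bound, never the
  exponent. The two rays complement each other: \<open>sin (k * m * pi / n)\<close> vanishes exactly
  at the multiples of \<open>n\<close>, whose least positive member \<open>n\<close> is the exponent
  in the decay along the irrational ray, where no \<open>sin (k * \<theta>)\<close> with
  \<open>k > 0\<close> vanishes.\<close>

lemma open_upper_half_plane: "open upper_half_plane"
  unfolding upper_half_plane_def by (rule open_halfspace_Im_gt)

lemma convex_upper_half_plane: "convex upper_half_plane"
  unfolding upper_half_plane_def by (rule convex_halfspace_Im_gt)

lemma dir_deriv_1_has_vector_derivative: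
  assumes "has_dir_deriv 1 f (Complex x y)"
  shows "((\<lambda>x. f (Complex x y)) has_vector_derivative dir_deriv 1 f (Complex x y)) (at x)"
proof -
  let ?g = "\<lambda>t::real. f (Complex x y + of_real t * 1)"
  have "(?g has_vector_derivative dir_deriv 1 f (Complex x y)) (at (x - x))"
    using assms unfolding has_dir_deriv_def dir_deriv_def by (simp add: vector_derivative_works[symmetric])
  then have "((?g \<circ> (\<lambda>s. s - x)) has_vector_derivative (1 *\<^sub>R dir_deriv 1 f (Complex x y))) (at x)"
    by (intro vector_diff_chain_at) (auto intro!: derivative_eq_intros)
  moreover have "Complex x y + of_real (s - x) * 1 = Complex s y" for s
    by (simp add: complex_eq_iff)
  then have "?g \<circ> (\<lambda>s. s - x) = (\<lambda>x. f (Complex x y))"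
    by (simp only: o_def)
  ultimately show ?thesis by simp
qed

lemma dir_deriv_ii_has_vector_derivative:
  assumes "has_dir_deriv \<i> f (Complex x y)"
  shows "((\<lambda>y. f (Complex x y)) has_vector_derivative dir_deriv \<i> f (Complex x y)) (at y)"
proof -
  let ?g = "\<lambda>t::real. f (Complex x y + of_real t * \<i>)"
  have "(?g has_vector_derivative dir_deriv \<i> f (Complex x y)) (at (y - y))"
    using assms unfolding has_dir_deriv_def dir_deriv_def by (simp add: vector_derivative_works[symmetric])
  then have "((?g \<circ> (\<lambda>s. s - y)) has_vector_derivative (1 *\<^sub>R dir_deriv \<i> f (Complex x y))) (at y)"
    by (intro vector_diff_chain_at) (auto intro!: derivative_eq_intros)
  moreover have "Complex x y + of_real (s - y) * \<i> = Complex x s" for s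
    by (simp add: complex_eq_iff)
  then have "?g \<circ> (\<lambda>s. s - y) = (\<lambda>y. f (Complex x y))"
    by (simp only: o_def)
  ultimately show ?thesis by simp
qed

text \<open>The two partial derivatives \<open>p\<close> and \<open>\<i> * p\<close> encode the
  Cauchy-Riemann equations. Continuity of \<open>p\<close> yields total differentiability, and the
  resulting real-linear map is multiplication by \<open>p z\<close>.\<close>

lemma has_field_derivative_of_partials:
  fixes f :: "complex \<Rightarrow> complex"
  assumes "open S" "continuous_on S p" "z \<in> S"
    and dx: "\<And>x y. Complex x y \<in> S \<Longrightarrow>
      ((\<lambda>x. f (Complex x y)) has_vector_derivative p (Complex x y)) (at x)"
    and dy: "\<And>x y. Complex x y \<in> S \<Longrightarrow>
      ((\<lambda>y. f (Complex x y)) has_vector_derivative \<i> * p (Complex x y)) (at y)"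
  shows "(f has_field_derivative p z) (at z)"
proof -
  obtain e where e: "e > 0" "ball z e \<subseteq> S" using assms open_contains_ball by blast
  define X where "X = ball (Re z) (e/2)"
  define Y where "Y = ball (Im z) (e/2)"
  have S: "Complex x y \<in> S" if "x \<in> X" "y \<in> Y" for x y
  proof -
    have "cmod (z - Complex x y) \<le> \<bar>Re (z - Complex x y)\<bar> + \<bar>Im (z - Complex x y)\<bar>"
      by (rule cmod_le)
    also have "\<dots> < e/2 + e/2"
      using that by (intro add_strict_mono) (auto simp: X_def Y_def dist_real_def)
    finally have "Complex x y \<in> ball z e" by (simp add: dist_norm)
    then show ?thesis using e by blast
  qed
  let ?fy = "\<lambda>x y. blinfun_scaleR_left (\<i> * p (Complex x y))"
  have "continuous_on (X \<times> Y) (\<lambda>(x,y). p (Complex x y))"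
    unfolding case_prod_unfold
    by (rule continuous_on_compose2[OF assms(2)]) (auto intro!: S, simp add: Complex_eq, intro continuous_intros)
  then have c: "continuous_on (X \<times> Y) (\<lambda>(x,y). ?fy x y)"
    unfolding case_prod_unfold by (intro continuous_intros) auto
  have XY: "(Re z, Im z) \<in> X \<times> Y" "open (X \<times> Y)"
    using e by (auto simp: X_def Y_def intro!: open_Times)
  have "((\<lambda>(x,y). f (Complex x y)) has_derivative (\<lambda>(tx,ty). tx *\<^sub>R p z + blinfun_apply (?fy (Re z) (Im z)) ty))
      (at (Re z, Im z) within X \<times> Y)"
  proof (rule has_derivative_partialsI)
    show "((\<lambda>x. f (Complex x (Im z))) has_derivative (\<lambda>tx. tx *\<^sub>R p z)) (at (Re z) within X)"
      using dx[of "Re z" "Im z"] \<open>z \<in> S\<close> by (auto simp: has_vector_derivative_def intro: has_derivative_at_withinI)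
    show "((\<lambda>y. f (Complex x y)) has_derivative blinfun_apply (?fy x y)) (at y within Y)"
      if "x \<in> X" "y \<in> Y" for x y
      using dy[OF S[OF that]]
      by (auto simp: has_vector_derivative_def intro: has_derivative_at_withinI)
    show "continuous (at (Re z, Im z) within X \<times> Y) (\<lambda>(x,y). ?fy x y)"
      using c XY by (auto simp: continuous_on_eq_continuous_within)
  qed (use e in \<open>auto simp: Y_def\<close>)
  then have "((\<lambda>(x,y). f (Complex x y)) has_derivative (\<lambda>(tx,ty). tx *\<^sub>R p z + ty *\<^sub>R (\<i> * p z)))
      (at (Re z, Im z))"
    using at_within_open[OF XY] by simp
  moreover have "((\<lambda>z. (Re z, Im z)) has_derivative (\<lambda>h. (Re h, Im h))) (at z)"
    by (auto intro!: derivative_eq_intros)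
  ultimately have "((\<lambda>z. (\<lambda>(x,y). f (Complex x y)) (Re z, Im z)) has_derivative
      (\<lambda>h. (\<lambda>(tx,ty). tx *\<^sub>R p z + ty *\<^sub>R (\<i> * p z)) (Re h, Im h))) (at z)"
    by (rule has_derivative_compose[rotated])
  moreover have "(\<lambda>h. (\<lambda>(tx,ty). tx *\<^sub>R p z + ty *\<^sub>R (\<i> * p z)) (Re h, Im h)) = (*) (p z)"
    by (rule ext) (auto simp: complex_eq_iff algebra_simps)
  ultimately show ?thesis by (simp add: has_field_derivative_def)
qed

text \<open>Schwarz's theorem by way of integrals: \<open>f\<close> at height \<open>b\<close> is
  its value at height \<open>a\<close> plus the integral of \<open>q\<close>. Differentiating this
  in \<open>x\<close> under the integral exhibits \<open>p\<close> as a vertical primitive of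
  \<open>s\<close>, so its vertical derivative \<open>r\<close> must be \<open>s\<close>.\<close>

lemma mixed_partials_eq:
  fixes f :: "complex \<Rightarrow> complex"
  assumes dx: "\<And>x y. y > 0 \<Longrightarrow> ((\<lambda>x. f (Complex x y)) has_vector_derivative p (Complex x y)) (at x)"
    and dy: "\<And>x y. y > 0 \<Longrightarrow> ((\<lambda>y. f (Complex x y)) has_vector_derivative q (Complex x y)) (at y)"
    and pdy: "\<And>x y. y > 0 \<Longrightarrow> ((\<lambda>y. p (Complex x y)) has_vector_derivative r (Complex x y)) (at y)"
    and qdx: "\<And>x y. y > 0 \<Longrightarrow> ((\<lambda>x. q (Complex x y)) has_vector_derivative s (Complex x y)) (at x)"
    and cq: "continuous_on upper_half_plane q"
    and cs: "continuous_on upper_half_plane s"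
    and "y > 0"
  shows "r (Complex x y) = s (Complex x y)"
proof -
  \<comment> \<open>Half the height keeps all segments starting at \<open>a\<close> inside the
    half-plane. Together with the upper end \<open>y + 1\<close> used below it makes
    \<open>y\<close> an interior point, where the derivative within the interval is the full
    one.\<close>
  define a where "a = y / 2"
  have a: "0 < a" "a < y" using \<open>y > 0\<close> by (auto simp: a_def)
  have cq': "continuous_on {a..b} (\<lambda>t. q (Complex x t))" for x b
    by (rule continuous_on_compose2[OF cq])
       (use a in \<open>auto intro!: continuous_intros simp: Complex_eq upper_half_plane_def\<close>)
  have cs': "continuous_on {a..b} (\<lambda>t. s (Complex x t))" for x b
    by (rule continuous_on_compose2[OF cs])
       (use a in \<open>auto intro!: continuous_intros simp: Complex_eq upper_half_plane_def\<close>)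
  have p_eq: "p (Complex x b) = p (Complex x a) + integral {a..b} (\<lambda>t. s (Complex x t))"
    if b: "b \<ge> a" for x b
  proof -
    have f_eq: "f (Complex x b) = f (Complex x a) + integral {a..b} (\<lambda>t. q (Complex x t))" for x
    proof -
      have "((\<lambda>t. q (Complex x t)) has_integral f (Complex x b) - f (Complex x a)) {a..b}"
        using a b by (intro fundamental_theorem_of_calculus)
          (auto intro!: has_vector_derivative_at_within dy)
      then show ?thesis by (simp add: integral_unique)
    qed
    have "((\<lambda>x. integral (cbox a b) (\<lambda>t. q (Complex x t))) has_vector_derivative
            integral (cbox a b) (\<lambda>t. s (Complex x t))) (at x within UNIV)"
    proof (rule leibniz_rule_vector_derivative)
      show "continuous_on (UNIV \<times> cbox a b) (\<lambda>(x, t). s (Complex x t))"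
        unfolding case_prod_unfold
        by (rule continuous_on_compose2[OF cs])
           (use a in \<open>auto intro!: continuous_intros simp: Complex_eq upper_half_plane_def\<close>)
      show "((\<lambda>x. q (Complex x t)) has_vector_derivative s (Complex x t)) (at x within UNIV)"
        if "t \<in> cbox a b" for x t
        using qdx[of t x] that a by simp
      show "(\<lambda>t. q (Complex x t)) integrable_on cbox a b" for x
        using integrable_continuous_interval[OF cq'[of b x]] by simp
    qed auto
    then have "((\<lambda>x. f (Complex x a) + integral {a..b} (\<lambda>t. q (Complex x t))) has_vector_derivative
            p (Complex x a) + integral {a..b} (\<lambda>t. s (Complex x t))) (at x)"
      using a by (intro has_vector_derivative_add dx) auto
    then have d: "((\<lambda>x. f (Complex x b)) has_vector_derivative
            p (Complex x a) + integral {a..b} (\<lambda>t. s (Complex x t))) (at x)"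
      by (simp only: f_eq)
    have "0 < b" using a b by simp
    show ?thesis by (rule vector_derivative_unique_at[OF dx[OF \<open>0 < b\<close>] d])
  qed
  have y: "y \<in> {a..y+1}" using a by auto
  have "((\<lambda>b. integral {a..b} (\<lambda>t. s (Complex x t))) has_vector_derivative s (Complex x y)) (at y within {a..y+1})"
    by (rule integral_has_vector_derivative[OF cs' y])
  then have "((\<lambda>b. p (Complex x a) + integral {a..b} (\<lambda>t. s (Complex x t))) has_vector_derivative s (Complex x y))
     (at y within {a..y+1})"
    by (auto intro!: derivative_eq_intros)
  then have d: "((\<lambda>b. p (Complex x b)) has_vector_derivative s (Complex x y)) (at y within {a..y+1})"
    by (rule has_vector_derivative_transform[rotated 2]) (use y in \<open>auto intro!: p_eq\<close>)
  have w: "at y within {a..y+1} = at y"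
    using a by (intro at_within_Icc_at) auto
  show ?thesis by (rule vector_derivative_unique_at[OF pdy[OF \<open>y > 0\<close>] d[unfolded w]])
qed

text \<open>With \<open>F = (u\<^sub>x - \<i> u\<^sub>y)/2\<close> and \<open>G = (u\<^sub>x + \<i> u\<^sub>y)/2 \<circ> cnj\<close>, the
  function \<open>A\<close> is a primitive of \<open>F\<close> and \<open>B\<close> one of \<open>G\<close>.\<close>

lemma harmonic_decomposition:
  assumes "harmonic_on u upper_half_plane"
  obtains A B where "A holomorphic_on upper_half_plane" "B holomorphic_on cnj ` upper_half_plane"
    "\<And>z. z \<in> upper_half_plane \<Longrightarrow> u z = A z + B (cnj z)"
proof -
  let ?H = upper_half_plane and ?L = "cnj ` upper_half_plane"
  define p where "p = dir_deriv 1 u"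
  define q where "q = dir_deriv \<i> u"
  have C1: "C1_on u ?H" "C1_on p ?H" "C1_on q ?H"
    and lap: "\<And>z. z \<in> ?H \<Longrightarrow> dir_deriv 1 p z + dir_deriv \<i> q z = 0"
    using assms unfolding harmonic_on_def C2_on_def laplacian_def p_def q_def by auto
  have inH: "Complex x y \<in> ?H \<longleftrightarrow> y > 0" for x y by (simp add: upper_half_plane_def)
  have inL: "z \<in> ?L \<longleftrightarrow> Im z < 0" for z
    by (auto simp: upper_half_plane_def image_iff complex_eq_iff intro!: exI[of _ "cnj z"])
  have cont: "continuous_on ?H p" "continuous_on ?H q"
      "continuous_on ?H (dir_deriv 1 p)" "continuous_on ?H (dir_deriv 1 q)"
    using C1 unfolding C1_on_def p_def q_def by auto
  have dx: "((\<lambda>x. f (Complex x y)) has_vector_derivative dir_deriv 1 f (Complex x y)) (at x)"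
    and dy: "((\<lambda>y. f (Complex x y)) has_vector_derivative dir_deriv \<i> f (Complex x y)) (at y)"
    if "C1_on f ?H" "y > 0" for f x y
    using that unfolding C1_on_def
    by (auto intro!: dir_deriv_1_has_vector_derivative dir_deriv_ii_has_vector_derivative simp: inH)
  note u = dx[OF C1(1), folded p_def] dy[OF C1(1), folded q_def]
  have mix: "dir_deriv \<i> p (Complex x y) = dir_deriv 1 q (Complex x y)" if "y > 0" for x y
    by (rule mixed_partials_eq[where f = u and p = p and q = q])
       (use u dx dy C1 cont that in auto)
  have lap': "dir_deriv \<i> q (Complex x y) = - dir_deriv 1 p (Complex x y)" if "y > 0" for x y
    using lap[of "Complex x y"] that by (simp add: inH add_eq_0_iff)
  \<comment> \<open>\<open>F\<close> is the Wirtinger derivative of \<open>u\<close> with respect to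
    \<open>z\<close>, and \<open>G\<close> the one with respect to \<open>cnj z\<close>, read at the
    reflected point. A vanishing Laplacian and equal mixed derivatives are precisely the
    Cauchy-Riemann equations for both.\<close>
  define F where "F = (\<lambda>z. (p z - \<i> * q z) / 2)"
  define G where "G = (\<lambda>z. (p (cnj z) + \<i> * q (cnj z)) / 2)"
  have "F holomorphic_on ?H"
  proof -
    have "(F has_field_derivative (dir_deriv 1 p z - \<i> * dir_deriv 1 q z) / 2) (at z)" if "z \<in> ?H" for z
    proof (rule has_field_derivative_of_partials[OF open_upper_half_plane _ that])
      show "continuous_on ?H (\<lambda>z. (dir_deriv 1 p z - \<i> * dir_deriv 1 q z) / 2)"
        by (intro continuous_intros cont) auto
    next
      fix x y assume "Complex x y \<in> ?H"
      then have y: "y > 0" by (simp add: inH)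
      show "((\<lambda>x. F (Complex x y)) has_vector_derivative
          (dir_deriv 1 p (Complex x y) - \<i> * dir_deriv 1 q (Complex x y)) / 2) (at x)"
        unfolding F_def
        by (intro has_vector_derivative_divide has_vector_derivative_diff has_vector_derivative_mult_right dx C1 y)
      have "((\<lambda>y. F (Complex x y)) has_vector_derivative
          (dir_deriv \<i> p (Complex x y) - \<i> * dir_deriv \<i> q (Complex x y)) / 2) (at y)"
        unfolding F_def
        by (intro has_vector_derivative_divide has_vector_derivative_diff has_vector_derivative_mult_right dy C1 y)
      then show "((\<lambda>y. F (Complex x y)) has_vector_derivative
          \<i> * ((dir_deriv 1 p (Complex x y) - \<i> * dir_deriv 1 q (Complex x y)) / 2)) (at y)"
        by (simp add: mix[OF y] lap'[OF y] algebra_simps)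
    qed
    then show ?thesis using holomorphic_on_open[OF open_upper_half_plane] by blast
  qed
  then obtain A where A: "\<And>z. z \<in> ?H \<Longrightarrow> (A has_field_derivative F z) (at z within ?H)"
    using holomorphic_convex_primitive'[OF convex_upper_half_plane open_upper_half_plane] by blast
  have L: "?L = {z. Im z < 0}" by (rule set_eqI) (simp only: inL mem_Collect_eq)
  have openL: "open ?L" unfolding L by (rule open_halfspace_Im_lt)
  have convexL: "convex ?L" unfolding L by (rule convex_halfspace_Im_lt)
  have cnjL: "cnj ` ?L \<subseteq> ?H" by auto
  have cmp: "continuous_on ?L (\<lambda>z. f (cnj z))" if "continuous_on ?H f" for f :: "complex \<Rightarrow> complex"
    by (rule continuous_on_compose2[OF that _ cnjL]) (intro continuous_intros)
  have cnjc: "cnj (Complex x y) = Complex x (- y)" for x y by (simp add: complex_eq_iff)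
  have neg: "((\<lambda>y. f (Complex x (- y))) has_vector_derivative - D) (at y)"
    if "((\<lambda>y. f (Complex x y)) has_vector_derivative D) (at (- y))" for f :: "complex \<Rightarrow> complex" and D x y
  proof -
    have "((\<lambda>y. f (Complex x y)) \<circ> uminus has_vector_derivative ((-1) *\<^sub>R D)) (at y)"
      by (rule vector_diff_chain_at) (use that in \<open>auto intro!: derivative_eq_intros\<close>)
    then show ?thesis by (simp add: o_def)
  qed
  have "G holomorphic_on ?L"
  proof -
    have "(G has_field_derivative (dir_deriv 1 p (cnj z) + \<i> * dir_deriv 1 q (cnj z)) / 2) (at z)" if "z \<in> ?L" for z
    proof (rule has_field_derivative_of_partials[OF openL _ that])
      show "continuous_on ?L (\<lambda>z. (dir_deriv 1 p (cnj z) + \<i> * dir_deriv 1 q (cnj z)) / 2)"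
        by (intro continuous_intros cmp cont) auto
    next
      fix x y assume "Complex x y \<in> ?L"
      then have y: "- y > 0" by (simp add: inL)
      show "((\<lambda>x. G (Complex x y)) has_vector_derivative
          (dir_deriv 1 p (cnj (Complex x y)) + \<i> * dir_deriv 1 q (cnj (Complex x y))) / 2) (at x)"
        unfolding G_def cnjc
        by (intro has_vector_derivative_divide has_vector_derivative_add has_vector_derivative_mult_right dx C1 y)
      have "((\<lambda>y. G (Complex x y)) has_vector_derivative
          (- dir_deriv \<i> p (Complex x (-y)) + \<i> * (- dir_deriv \<i> q (Complex x (- y)))) / 2) (at y)"
        unfolding G_def cnjc
        by (intro has_vector_derivative_divide has_vector_derivative_add has_vector_derivative_mult_right neg dy C1 y)
      then show "((\<lambda>y. G (Complex x y)) has_vector_derivative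
          \<i> * ((dir_deriv 1 p (cnj (Complex x y)) + \<i> * dir_deriv 1 q (cnj (Complex x y))) / 2)) (at y)"
        by (simp add: cnjc mix[OF y] lap'[OF y] algebra_simps)
    qed
    then show ?thesis using holomorphic_on_open[OF openL] by blast
  qed
  then obtain B where B: "\<And>z. z \<in> ?L \<Longrightarrow> (B has_field_derivative G z) (at z within ?L)"
    using holomorphic_convex_primitive'[OF convexL openL] by blast
  have A': "(A has_field_derivative F z) (at z)" if "z \<in> ?H" for z
    using A[OF that] at_within_open[OF that open_upper_half_plane] by simp
  have B': "(B has_field_derivative G z) (at z)" if "z \<in> ?L" for z
    using B[OF that] at_within_open[OF that openL] by simp
  have Cd: "((\<lambda>x. Complex x y) has_vector_derivative 1) (at x)"
    "((\<lambda>y. Complex x y) has_vector_derivative \<i>) (at y)" for x y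
    unfolding Complex_eq by (auto intro!: derivative_eq_intros has_vector_derivative_real_field)
  \<comment> \<open>The partial derivatives of \<open>u\<close> are \<open>F + G \<circ> cnj\<close>
    and \<open>\<i> * (F - G \<circ> cnj)\<close>, so the defect \<open>D\<close> has zero gradient.
    Its constant value is finally absorbed into the holomorphic summand.\<close>
  define D where "D = (\<lambda>z. u z - (A z + B (cnj z)))"
  have "(D has_field_derivative 0) (at z within ?H)" if "z \<in> ?H" for z
  proof -
    have "(D has_field_derivative (\<lambda>_. 0) z) (at z)"
    proof (rule has_field_derivative_of_partials[OF open_upper_half_plane _ that])
      fix x y assume "Complex x y \<in> ?H"
      then have y: "y > 0" by (simp add: inH)
      have AH: "(A has_field_derivative F (Complex x y)) (at (Complex x y))" by (rule A') (simp add: inH y)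
      have BH: "(B has_field_derivative G (Complex x (- y))) (at (Complex x (- y)))"
        by (rule B') (simp add: inL y)
      have FG: "F (Complex x y) + G (Complex x (-y)) = p (Complex x y)"
         "\<i> * F (Complex x y) - \<i> * G (Complex x (-y)) = q (Complex x y)"
        by (simp_all add: F_def G_def cnjc field_simps)
      have "((\<lambda>x. D (Complex x y)) has_vector_derivative
          p (Complex x y) - (1 * F (Complex x y) + 1 * G (Complex x (- y)))) (at x)"
        unfolding D_def cnjc
        by (intro has_vector_derivative_diff has_vector_derivative_add u y
              field_vector_diff_chain_at[OF Cd(1) AH, unfolded o_def]
              field_vector_diff_chain_at[OF Cd(1) BH, unfolded o_def])
      then show "((\<lambda>x. D (Complex x y)) has_vector_derivative 0) (at x)" by (simp add: FG)
      have "((\<lambda>y. B (Complex x (-y))) has_vector_derivative - (\<i> * G (Complex x (- y)))) (at y)"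
        by (intro neg field_vector_diff_chain_at[OF Cd(2) BH, unfolded o_def])
      then have "((\<lambda>y. D (Complex x y)) has_vector_derivative
          q (Complex x y) - (\<i> * F (Complex x y) + - (\<i> * G (Complex x (- y))))) (at y)"
        unfolding D_def cnjc
        by (intro has_vector_derivative_diff has_vector_derivative_add u y
              field_vector_diff_chain_at[OF Cd(2) AH, unfolded o_def])
      then show "((\<lambda>y. D (Complex x y)) has_vector_derivative \<i> * 0) (at y)" by (simp add: FG)
    qed auto
    then show ?thesis by (simp add: has_field_derivative_at_within)
  qed
  then obtain c where c: "\<And>z. z \<in> ?H \<Longrightarrow> D z = c"
    using has_field_derivative_zero_constant[OF convex_upper_half_plane] by metis
  show thesis
  proof (rule that[of "\<lambda>z. A z + c" B])
    show "(\<lambda>z. A z + c) holomorphic_on ?H"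
      using A' by (intro holomorphic_intros) (auto simp: holomorphic_on_open[OF open_upper_half_plane])
    show "B holomorphic_on ?L"
      using B' by (auto simp: holomorphic_on_open[OF openL])
    show "u z = A z + c + B (cnj z)" if "z \<in> ?H" for z
      using c[OF that] by (simp add: D_def algebra_simps)
  qed
qed

section \<open>Horizontal mollification\<close>

text \<open>A smooth bump is carried together with all its derivatives, so differentiation becomes
  an index shift. Since the endpoints of the support interval are included in the vanishing
  condition, integration by parts leaves no boundary terms.\<close>

definition bump_derivs :: "(nat \<Rightarrow> real \<Rightarrow> complex) \<Rightarrow> bool" where
  "bump_derivs D \<longleftrightarrow>
     (\<forall>k x. (D k has_vector_derivative D (Suc k) x) (at x)) \<and> (\<forall>k x. 1 \<le> \<bar>x\<bar> \<longrightarrow> D k x = 0)"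

text \<open>A correlation rather than a convolution: its value at \<open>Complex x y\<close> is the
  pairing of \<open>f\<close> at height \<open>y\<close> with the bump translated to
  \<open>x\<close>. The price is a minus sign in each derivative.\<close>

definition mollify :: "(real \<Rightarrow> complex) \<Rightarrow> (complex \<Rightarrow> complex) \<Rightarrow> complex \<Rightarrow> complex" where
  "mollify \<phi> f z = integral {-1..1} (\<lambda>t. f (z + of_real t) * \<phi> t)"

lemma bump_derivs_shift: "bump_derivs D \<Longrightarrow> bump_derivs (\<lambda>j. D (k + j))"
  by (auto simp: bump_derivs_def)

lemma bump_derivs_continuous_on: "bump_derivs D \<Longrightarrow> continuous_on S (D k)"
  unfolding bump_derivs_def
  by (meson continuous_at_imp_continuous_on has_vector_derivative_continuous)

lemma bump_derivs_bounded:
  assumes "bump_derivs D"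
  obtains K where "\<And>t. norm (D k t) \<le> K"
proof -
  have "compact (D k ` {-1..1})"
    by (intro compact_continuous_image bump_derivs_continuous_on assms compact_Icc)
  then obtain K where K: "\<And>t. t \<in> {-1..1} \<Longrightarrow> norm (D k t) \<le> K"
    by (meson bounded_iff compact_imp_bounded imageI)
  have "norm (D k t) \<le> max K 0" for t
    using K[of t] assms by (cases "\<bar>t\<bar> \<le> 1") (auto simp: bump_derivs_def abs_le_iff)
  then show thesis using that by blast
qed

text \<open>Differentiation under the integral puts the derivative on \<open>f\<close>; integration
  by parts moves it to the bump. A bound that holds for every bump is therefore also a bound for all
  derivatives of the mollified function.\<close>

lemma mollify_has_field_derivative:
  assumes D: "bump_derivs D" and f: "f holomorphic_on S" and S: "open S" "convex S"
    and inv: "\<And>z t. z \<in> S \<Longrightarrow> z + of_real t \<in> S" and "z \<in> S"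
  shows "(mollify (D k) f has_field_derivative - mollify (D (Suc k)) f z) (at z)"
proof -
  have f': "(f has_field_derivative deriv f w) (at w)" if "w \<in> S" for w
    using holomorphic_derivI[OF f S(1) that] .
  have df: "deriv f holomorphic_on S" using holomorphic_deriv[OF f S(1)] .
  have cont: "continuous_on (S \<times> cbox (-1) 1) (\<lambda>(z, t). g (z + of_real t) * D k t)"
    if "g holomorphic_on S" for g :: "complex \<Rightarrow> complex" and k
    unfolding case_prod_unfold
    by (intro continuous_intros continuous_on_compose2[OF holomorphic_on_imp_continuous_on[OF that]]
          continuous_on_compose2[OF bump_derivs_continuous_on[OF D, of UNIV k]])
       (auto intro: inv)
  have cont1: "continuous_on {-1..1} (\<lambda>t. g (z + of_real t) * D k t)"
    if "g holomorphic_on S" "z \<in> S" for g :: "complex \<Rightarrow> complex" and k z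
    by (intro continuous_intros continuous_on_compose2[OF holomorphic_on_imp_continuous_on[OF that(1)]]
          bump_derivs_continuous_on[OF D])
       (use that in \<open>auto intro: inv\<close>)
  have "((\<lambda>z. integral (cbox (-1) 1) (\<lambda>t. f (z + of_real t) * D k t)) has_field_derivative
      integral (cbox (-1) 1) (\<lambda>t. deriv f (z + of_real t) * D k t)) (at z within S)"
  proof (rule leibniz_rule_field_derivative)
    fix z t assume "z \<in> S" "t \<in> cbox (-1::real) 1"
    then have "((\<lambda>z. f (z + of_real t)) has_field_derivative deriv f (z + of_real t)) (at z)"
      using f'[OF inv[OF \<open>z \<in> S\<close>, of t]] by (simp only: DERIV_shift)
    then show "((\<lambda>z. f (z + of_real t) * D k t) has_field_derivative
        deriv f (z + of_real t) * D k t) (at z within S)"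
      by (intro has_field_derivative_at_within[OF DERIV_cmult_right])
  next
    show "(\<lambda>t. f (z + of_real t) * D k t) integrable_on cbox (-1) 1" if "z \<in> S" for z
      using integrable_continuous_interval[OF cont1[OF f that]] by simp
  qed (use cont[OF df] S \<open>z \<in> S\<close> in auto)
  then have "(mollify (D k) f has_field_derivative mollify (D k) (deriv f) z) (at z)"
    unfolding mollify_def[abs_def] using at_within_open[OF \<open>z \<in> S\<close> S(1)] by simp
  moreover have "mollify (D k) (deriv f) z = - mollify (D (Suc k)) f z"
  proof -
    have "((\<lambda>t. deriv f (z + of_real t) * D k t) has_integral - mollify (D (Suc k)) f z) {-1..1}"
    proof (rule integration_by_parts[OF bounded_bilinear_mult])
      show "continuous_on {-1..1} (\<lambda>t. f (z + of_real t))"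
        by (intro continuous_intros continuous_on_compose2[OF holomorphic_on_imp_continuous_on[OF f]])
          (auto intro: inv \<open>z \<in> S\<close>)
      show "continuous_on {-1..1} (D k)" by (rule bump_derivs_continuous_on[OF D])
      show "(D k has_vector_derivative D (Suc k) x) (at x)" for x
        using D by (auto simp: bump_derivs_def)
      show "((\<lambda>t. f (z + of_real t)) has_vector_derivative deriv f (z + of_real t)) (at t)" for t
      proof -
        have "((\<lambda>t. z + complex_of_real t) has_vector_derivative 1) (at t)"
          by (auto intro!: derivative_eq_intros)
        from field_vector_diff_chain_at[OF this f'[OF inv[OF \<open>z \<in> S\<close>]]]
        show ?thesis by (simp add: o_def)
      qed
      have "((\<lambda>t. f (z + of_real t) * D (Suc k) t) has_integral mollify (D (Suc k)) f z) {-1..1}"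
        unfolding mollify_def
        using integrable_integral[OF integrable_continuous_interval[OF cont1[OF f \<open>z \<in> S\<close>]]] .
      then show "((\<lambda>t. f (z + of_real t) * D (Suc k) t) has_integral
         f (z + of_real 1) * D k 1 - f (z + of_real (-1)) * D k (-1) - - mollify (D (Suc k)) f z) {-1..1}"
        using D by (simp add: bump_derivs_def)
    qed auto
    then show ?thesis unfolding mollify_def by (rule integral_unique)
  qed
  ultimately show ?thesis by simp
qed

text \<open>The bridge between the Lebesgue integral over the line, in which boundary values are
  expressed, and the gauge integral over the support, in which mollification is expressed.\<close>

lemma integrable_mult_bump:
  fixes g \<phi> :: "real \<Rightarrow> complex"
  assumes "continuous_on UNIV g" "continuous_on UNIV \<phi>" "\<And>t. 1 \<le> \<bar>t\<bar> \<Longrightarrow> \<phi> t = 0"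
  shows "integrable lborel (\<lambda>t. g t * \<phi> (t - x))"
    and "(LINT t|lborel. g t * \<phi> (t - x)) = integral {-1..1} (\<lambda>t. g (x + t) * \<phi> t)"
proof -
  have eq: "(\<lambda>t. indicator {-1..1} t *\<^sub>R (g (x + t) * \<phi> t)) = (\<lambda>t. g (x + t) * \<phi> t)"
    using assms(3) by (force simp: indicator_def fun_eq_iff)
  have c: "continuous_on {-1..1} (\<lambda>t. g (x + t) * \<phi> t)"
    by (intro continuous_intros continuous_on_compose2[OF assms(1)] continuous_on_subset[OF assms(2)]) auto
  have s: "set_integrable lborel {-1..1} (\<lambda>t. g (x + t) * \<phi> t)"
    by (rule borel_integrable_atLeastAtMost'[OF c])
  then have i: "integrable lborel (\<lambda>t. g (x + t) * \<phi> t)"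
    by (simp only: set_integrable_def eq)
  have "integrable lborel (\<lambda>t. (\<lambda>t. g t * \<phi> (t - x)) (x + 1 * t))"
    using i by simp
  then show "integrable lborel (\<lambda>t. g t * \<phi> (t - x))"
    by (subst (asm) lborel_integrable_real_affine_iff) auto
  have "(LINT t|lborel. g t * \<phi> (t - x)) = (LINT t|lborel. g (x + t) * \<phi> t)"
    by (subst lborel_integral_real_affine[where c = 1 and t = x]) auto
  also have "\<dots> = integral {-1..1} (\<lambda>t. g (x + t) * \<phi> t)"
    using set_borel_integral_eq_integral(2)[OF s] by (simp only: set_lebesgue_integral_def eq)
  finally show "(LINT t|lborel. g t * \<phi> (t - x)) = integral {-1..1} (\<lambda>t. g (x + t) * \<phi> t)" .
qed

lemma mollify_eq_lint:
  assumes "bump_derivs D" "continuous_on upper_half_plane u" "y > 0"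
  shows "mollify (D k) u (Complex x y) = (LINT t|lborel. u (Complex t y) * D k (t - x))"
proof -
  have "continuous_on UNIV (\<lambda>t. u (Complex t y))"
    by (rule continuous_on_compose2[OF assms(2)])
       (use assms(3) in \<open>auto simp: Complex_eq upper_half_plane_def intro!: continuous_intros\<close>)
  moreover have "Complex (x + t) y = Complex x y + of_real t" for t by (simp add: complex_eq_iff)
  moreover have "D k t = 0" if "1 \<le> \<bar>t\<bar>" for t using that assms(1) by (simp add: bump_derivs_def)
  ultimately show ?thesis
    using integrable_mult_bump(2)[of "\<lambda>t. u (Complex t y)" "D k" x] bump_derivs_continuous_on[OF assms(1)]
    by (simp add: mollify_def)
qed

section \<open>Local boundedness near the real axis\<close>

context
  notes sum.cong[fundef_cong]
begin

text \<open>Think of \<open>w i n\<close> as the value of the \<open>n\<close>-th functional on the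
  \<open>i\<close>-th hump. The choice is greedy: hump \<open>n\<close> is left out if the earlier
  humps already give functional \<open>n\<close> a large value, since adding it could cancel that
  value. The congruence rule for sums lets the termination proof see that only smaller indices are
  called.\<close>

fun hump_coeff :: "(nat \<Rightarrow> nat \<Rightarrow> complex) \<Rightarrow> nat \<Rightarrow> real" where
  "hump_coeff w n =
    (if norm (\<Sum>i<n. of_real (hump_coeff w i) * w i n) \<ge> (1/4)^n * norm (w n n) / 2 then 0 else (1/4)^n)"

end

declare hump_coeff.simps [simp del]

lemma hump_coeff_bounds: "0 \<le> hump_coeff w n" "hump_coeff w n \<le> (1/4)^n"
  by (simp_all add: hump_coeff.simps[of w n])

lemma summable_hump_coeff: "summable (hump_coeff w)"
  by (rule summable_comparison_test'[of "\<lambda>n. (1/4)^n" 0])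
     (auto simp: hump_coeff_bounds intro: summable_geometric)

text \<open>In either branch of the greedy choice the humps up to \<open>n\<close> contribute at
  least half of \<open>(1/4)^n * norm (w n n)\<close>. By the dominance hypothesis the later humps
  contribute at most a geometric tail, one third of that quantity, and
  \<open>1/6 = 1/2 - 1/3\<close>.\<close>

lemma gliding_hump:
  assumes w: "\<And>i n. norm (w i n) \<le> norm (w n n)"
  shows "norm (\<Sum>i. of_real (hump_coeff w i) * w i n) \<ge> (1/4)^n * norm (w n n) / 6"
proof -
  define a where "a = hump_coeff w"
  have a: "0 \<le> a i" "a i \<le> (1/4)^i" for i
    unfolding a_def by (rule hump_coeff_bounds)+
  have bd: "norm (of_real (a i) * w i n) \<le> (1/4)^i * norm (w n n)" for i
    using a[of i] w[of i n] by (auto simp: norm_mult intro!: mult_mono)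
  have sg: "summable (\<lambda>i. (1/4)^i * norm (w n n))"
    by (intro summable_mult2 summable_geometric) auto
  have sm: "summable (\<lambda>i. of_real (a i) * w i n)"
    by (rule summable_comparison_test'[OF sg, of 0]) (use bd in auto)
  define s where "s = (\<Sum>i<n. of_real (a i) * w i n)"
  have tri: "norm q \<le> norm p + norm r" if "p = r + q" for p q r :: complex
    using norm_triangle_ineq4[of p r] that by simp
  have part: "norm (s + of_real (a n) * w n n) \<ge> (1/4)^n * norm (w n n) / 2"
  proof (cases "norm s \<ge> (1/4)^n * norm (w n n) / 2")
    case True
    then have "a n = 0" unfolding s_def a_def by (subst hump_coeff.simps) auto
    then show ?thesis using True by simp
  next
    case False
    then have "a n = (1/4)^n" unfolding s_def a_def by (subst hump_coeff.simps) auto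
    moreover have "norm (of_real (a n) * w n n) \<le> norm (s + of_real (a n) * w n n) + norm s"
      by (rule tri) (rule refl)
    ultimately show ?thesis using False by (simp add: norm_mult norm_power norm_divide)
  qed
  have tail: "norm (\<Sum>i. of_real (a (i + Suc n)) * w (i + Suc n) n) \<le> (1/4)^n * norm (w n n) / 3"
  proof -
    have "norm (\<Sum>i. of_real (a (i + Suc n)) * w (i + Suc n) n) \<le>
        (\<Sum>i. (1/4)^(i + Suc n) * norm (w n n))"
      by (rule norm_suminf_le[OF bd]) (rule summable_ignore_initial_segment[OF sg])
    also have "(\<lambda>i. (1/4)^(i + Suc n) * norm (w n n)) = (\<lambda>i. ((1/4)^Suc n * norm (w n n)) * (1/4)^i)"
      by (simp add: power_add mult_ac)
    also have "(\<Sum>i. ((1/4)^Suc n * norm (w n n)) * (1/4)^i) = ((1/4)^Suc n * norm (w n n)) * (4/3)"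
      by (subst suminf_mult) (auto simp: suminf_geometric summable_geometric)
    finally show ?thesis by simp
  qed
  have "(\<Sum>i. of_real (a i) * w i n) =
      (\<Sum>i. of_real (a (i + Suc n)) * w (i + Suc n) n) + (s + of_real (a n) * w n n)"
    using suminf_split_initial_segment[OF sm, of "Suc n"] by (simp add: s_def)
  then have "norm (s + of_real (a n) * w n n) \<le> norm (\<Sum>i. of_real (a i) * w i n) +
     norm (\<Sum>i. of_real (a (i + Suc n)) * w (i + Suc n) n)"
    by (rule tri)
  then show ?thesis using part tail unfolding a_def by linarith
qed

lemma test_functionI:
  assumes D: "\<And>k x. (D k has_vector_derivative D (Suc k) x) (at x)"
    and supp: "\<And>t. \<bar>t\<bar> > r \<Longrightarrow> D 0 t = 0"
  shows "test_function (D 0)"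
proof -
  have "((\<lambda>f t. vector_derivative f (at t)) ^^ k) (D 0) = D k" for k
    by (induction k) (auto simp: vector_derivative_at[OF D])
  moreover have "D k differentiable (at x)" for k x
    using D by (rule differentiableI_vector)
  moreover have "bounded {x. D 0 x \<noteq> 0}"
    by (rule bounded_subset[of "{-r..r}"]) (use supp in \<open>force simp: abs_le_iff not_less[symmetric]\<close>)+
  ultimately show ?thesis unfolding test_function_def by (simp add: compact_closure)
qed

text \<open>Each \<open>D k\<close> is bounded and the weights are summable, so the differentiated
  series converges uniformly in \<open>t\<close>, wherever the centres \<open>x i\<close> lie.
  Applied for every \<open>k\<close>, this makes a superposition of infinitely many translates
  smooth.\<close>

lemma has_vector_derivative_bump_series:
  assumes D: "bump_derivs D" and a: "summable a" "\<And>i. 0 \<le> a i"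
  shows "((\<lambda>t. \<Sum>i. of_real (a i) * D k (t - x i)) has_vector_derivative
           (\<Sum>i. of_real (a i) * D (Suc k) (t - x i))) (at t)"
proof -
  have M: "\<exists>K. \<forall>i t. norm (of_real (a i) * D k (t - x i)) \<le> a i * K" for k
  proof -
    obtain K where "\<And>t. norm (D k t) \<le> K" using bump_derivs_bounded[OF D] by blast
    then show ?thesis using a(2) by (intro exI[of _ K]) (auto simp: norm_mult intro!: mult_left_mono)
  qed
  obtain K where K: "\<And>i t. norm (of_real (a i) * D k (t - x i)) \<le> a i * K" using M by blast
  obtain K' where K': "\<And>i t. norm (of_real (a i) * D (Suc k) (t - x i)) \<le> a i * K'" using M by blast
  let ?g' = "\<lambda>t. \<Sum>i. of_real (a i) * D (Suc k) (t - x i)"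
  have ul: "uniform_limit UNIV (\<lambda>n t. \<Sum>i<n. of_real (a i) * D (Suc k) (t - x i)) ?g' sequentially"
    by (rule Weierstrass_m_test[OF _ summable_mult2[OF a(1)]]) (rule K')
  have sm: "summable (\<lambda>i. of_real (a i) * D k (t - x i))" for t
    by (rule summable_comparison_test'[OF summable_mult2[OF a(1), of K], of 0]) (rule K)
  have "\<exists>g. \<forall>t\<in>UNIV. (\<lambda>i. of_real (a i) * D k (t - x i)) sums g t \<and>
      (g has_derivative (\<lambda>h. h *\<^sub>R ?g' t)) (at t within UNIV)"
  proof (rule has_derivative_series[where f' = "\<lambda>i t h. h *\<^sub>R (of_real (a i) * D (Suc k) (t - x i))"])
    show "((\<lambda>t. of_real (a i) * D k (t - x i)) has_derivative
        (\<lambda>h. h *\<^sub>R (of_real (a i) * D (Suc k) (t - x i)))) (at t within UNIV)" for i t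
    proof -
      have "(D k \<circ> (\<lambda>t. t - x i) has_vector_derivative 1 *\<^sub>R D (Suc k) (t - x i)) (at t)"
        by (rule vector_diff_chain_at)
           (use D in \<open>auto simp: bump_derivs_def intro!: derivative_eq_intros\<close>)
      then have "((\<lambda>t. D k (t - x i)) has_vector_derivative D (Suc k) (t - x i)) (at t)"
        by (simp add: o_def)
      from has_vector_derivative_mult_right[OF this, of "of_real (a i)"]
      show ?thesis by (simp add: has_vector_derivative_def)
    qed
    show "\<forall>\<^sub>F n in sequentially. \<forall>t\<in>UNIV. \<forall>h. norm ((\<Sum>i<n. h *\<^sub>R (of_real (a i) * D (Suc k) (t - x i))) -
         h *\<^sub>R ?g' t) \<le> e * norm h" if "e > 0" for e
      using uniform_limitD[OF ul that]
    proof eventually_elim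
      case (elim n)
      have "norm ((\<Sum>i<n. h *\<^sub>R (of_real (a i) * D (Suc k) (t - x i))) - h *\<^sub>R ?g' t) \<le> e * norm h" for t h
      proof -
        have "(\<Sum>i<n. h *\<^sub>R (of_real (a i) * D (Suc k) (t - x i))) - h *\<^sub>R ?g' t =
          h *\<^sub>R ((\<Sum>i<n. of_real (a i) * D (Suc k) (t - x i)) - ?g' t)"
          by (simp only: scaleR_right_diff_distrib scaleR_sum_right)
        moreover have "norm ((\<Sum>i<n. of_real (a i) * D (Suc k) (t - x i)) - ?g' t) \<le> e"
          using elim by (auto simp: dist_norm intro: less_imp_le)
        ultimately show ?thesis by (simp add: mult.commute[of e] mult_left_mono)
      qed
      then show ?case by blast
    qed
    show "(\<lambda>i. of_real (a i) * D k (0 - x i)) sums (\<Sum>i. of_real (a i) * D k (0 - x i))"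
      using sm by (rule summable_sums)
  qed auto
  then obtain g where g: "\<And>t. (\<lambda>i. of_real (a i) * D k (t - x i)) sums g t"
    "\<And>t. (g has_vector_derivative ?g' t) (at t)"
    by (auto simp: has_vector_derivative_def)
  have "g = (\<lambda>t. \<Sum>i. of_real (a i) * D k (t - x i))"
    using g(1) sums_unique by blast
  then show ?thesis using g(2) by simp
qed

text \<open>If the claim fails, the functionals \<open>\<psi> \<mapsto> \<integral> u(t + \<i> y\<^sub>n) \<psi>(t) dt\<close> are unbounded along
  translates of \<open>D 0\<close>, and a lacunary superposition of these translates is a test
  function contradicting the vanishing of the boundary values.\<close>

lemma mollify_bounded_near_boundary:
  assumes D: "bump_derivs D" and u: "continuous_on upper_half_plane u"
    and van: "vanishing_distributional_boundary_values u"
  shows "\<exists>M. \<forall>x y. \<bar>x\<bar> \<le> a \<and> 0 < y \<and> y \<le> 1 \<longrightarrow> norm (mollify (D 0) u (Complex x y)) \<le> M"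
proof (rule ccontr)
  assume neg: "\<not> ?thesis"
  define W where "W = (\<lambda>x y. mollify (D 0) u (Complex x y))"
  have ub: "\<exists>x y. \<bar>x\<bar> \<le> a \<and> 0 < y \<and> y \<le> 1 \<and> norm (W x y) > M" for M
    using neg unfolding W_def by (meson not_le)
  have contm: "continuous_on upper_half_plane (mollify (D 0) u)"
  proof -
    have "continuous_on upper_half_plane (\<lambda>z. integral (cbox (-1) 1) (\<lambda>t. u (z + of_real t) * D 0 t))"
      by (rule integral_continuous_on_param, unfold case_prod_unfold)
        (intro continuous_intros continuous_on_compose2[OF u]
          continuous_on_compose2[OF bump_derivs_continuous_on[OF D, of UNIV 0]];
          auto simp: upper_half_plane_def)
    then show ?thesis by (simp add: mollify_def[abs_def])
  qed
  have uy: "continuous_on UNIV (\<lambda>t. u (Complex t y))" if "y > 0" for y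
    by (rule continuous_on_compose2[OF u])
       (use that in \<open>auto simp: Complex_eq upper_half_plane_def intro!: continuous_intros\<close>)
  have D0: "continuous_on UNIV (D 0)" "\<And>t. 1 \<le> \<bar>t\<bar> \<Longrightarrow> D 0 t = 0"
    using bump_derivs_continuous_on[OF D] D by (auto simp: bump_derivs_def)
  have W_eq: "(LINT t|lborel. u (Complex t y) * D 0 (t - x)) = W x y" if "y > 0" for x y
    unfolding W_def by (rule mollify_eq_lint[OF D u that, symmetric])
  have int: "integrable lborel (\<lambda>t. u (Complex t y) * D 0 (t - x))" if "y > 0" for x y
    by (rule integrable_mult_bump(1)[OF uy[OF that] D0])
  \<comment> \<open>The factor \<open>6 * 4 ^ n\<close> offsets the loss in
    \<open>gliding_hump\<close>, so that the functionals stay at least 1 on the superposition. Large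
    values must occur low down, because \<open>W\<close> is bounded on the compact box above height
    \<open>1 / real (Suc n)\<close>. Moving to a maximiser on the same horizontal segment supplies
    the dominance hypothesis.\<close>
  have ex: "\<exists>x y. \<bar>x\<bar> \<le> a \<and> 0 < y \<and> y < 1 / real (Suc n) \<and> 6 * 4 ^ n \<le> norm (W x y) \<and>
     (\<forall>x'. \<bar>x'\<bar> \<le> a \<longrightarrow> norm (W x' y) \<le> norm (W x y))" for n
  proof -
    have sub: "Complex x y \<in> upper_half_plane" if "1 / real (Suc n) \<le> y" for x y
    proof -
      have "0 < 1 / real (Suc n)" by simp
      then show ?thesis using that unfolding upper_half_plane_def mem_Collect_eq complex.sel by linarith
    qed
    have cC: "continuous_on S (\<lambda>p. Complex (fst p) (snd p))" for S
      unfolding Complex_eq by (intro continuous_intros)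
    have "compact ((\<lambda>(x, y). W x y) ` ({-a..a} \<times> {1 / real (Suc n)..1}))"
      unfolding W_def case_prod_unfold
      by (intro compact_continuous_image compact_Times compact_Icc continuous_on_compose2[OF contm cC])
        (auto intro!: sub)
    then obtain K where "\<And>v. v \<in> (\<lambda>(x, y). W x y) ` ({-a..a} \<times> {1 / real (Suc n)..1}) \<Longrightarrow> norm v \<le> K"
      by (metis compact_imp_bounded bounded_iff)
    then have K: "\<And>x y. x \<in> {-a..a} \<Longrightarrow> y \<in> {1 / real (Suc n)..1} \<Longrightarrow> norm (W x y) \<le> K"
      by blast
    obtain x y where xy: "\<bar>x\<bar> \<le> a" "0 < y" "y \<le> 1" "norm (W x y) > max K (6 * 4 ^ n)"
      using ub by blast
    have y: "y < 1 / real (Suc n)"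
      using K[of x y] xy by (auto simp: abs_le_iff not_le[symmetric])
    have "continuous_on {-a..a} (\<lambda>x. norm (W x y))"
      unfolding W_def
      by (intro continuous_intros continuous_on_compose2[OF contm])
         (use \<open>0 < y\<close> in \<open>auto simp: Complex_eq upper_half_plane_def intro!: continuous_intros\<close>)
    moreover have xa: "x \<in> {-a..a}" using xy by auto
    ultimately obtain x0 where x0: "x0 \<in> {-a..a}" "\<And>x'. x' \<in> {-a..a} \<Longrightarrow> norm (W x' y) \<le> norm (W x0 y)"
      using continuous_attains_sup[of "{-a..a}" "\<lambda>x. norm (W x y)"] by (metis compact_Icc empty_iff)
    have "6 * 4 ^ n \<le> norm (W x0 y)" using x0(2)[OF xa] xy by simp
    then show ?thesis using x0 y xy by (intro exI[of _ x0] exI[of _ y]) (auto simp: abs_le_iff)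
  qed
  then obtain x y where x: "\<And>n. \<bar>x n\<bar> \<le> a" and y: "\<And>n. 0 < y n" "\<And>n. y n < 1 / real (Suc n)"
    and big: "\<And>n. 6 * 4 ^ n \<le> norm (W (x n) (y n))"
    and mx: "\<And>n x'. \<bar>x'\<bar> \<le> a \<Longrightarrow> norm (W x' (y n)) \<le> norm (W (x n) (y n))"
    by metis
  define w where "w = (\<lambda>i n. W (x i) (y n))"
  define c where "c = hump_coeff w"
  have c: "summable c" "\<And>i. 0 \<le> c i"
    unfolding c_def by (rule summable_hump_coeff hump_coeff_bounds)+
  define \<Psi> where "\<Psi> = (\<lambda>k t. \<Sum>i. of_real (c i) * D k (t - x i))"
  have "test_function (\<Psi> 0)"
  proof (rule test_functionI)
    show "(\<Psi> k has_vector_derivative \<Psi> (Suc k) t) (at t)" for k t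
      unfolding \<Psi>_def by (rule has_vector_derivative_bump_series[OF D c])
    show "\<Psi> 0 t = 0" if "\<bar>t\<bar> > a + 1" for t
    proof -
      have "D 0 (t - x i) = 0" for i using x[of i] that by (intro D0(2)) linarith
      then show ?thesis by (simp add: \<Psi>_def)
    qed
  qed
  then have lim: "((\<lambda>y. LINT t|lborel. u (Complex t y) * \<Psi> 0 t) \<longlongrightarrow> 0) (at_right 0)"
    using van unfolding vanishing_distributional_boundary_values_def by blast
  \<comment> \<open>Sum and integral may be exchanged: all translates vanish outside
    \<open>{-(a+1)..a+1}\<close>, where \<open>u\<close> at the fixed height \<open>y\<close> is
    bounded, so the integrals of the norms are at most a constant times \<open>c i\<close>.\<close>
  have lint: "(LINT t|lborel. u (Complex t y) * \<Psi> 0 t) = (\<Sum>i. of_real (c i) * W (x i) y)" if "y > 0" for y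
  proof -
    let ?f = "\<lambda>i t. of_real (c i) * (u (Complex t y) * D 0 (t - x i))"
    obtain K where K: "\<And>t. norm (D 0 t) \<le> K" using bump_derivs_bounded[OF D] by blast
    have nsm: "summable (\<lambda>i. norm (?f i t))" for t
    proof (rule summable_comparison_test'[of _ 0])
      show "summable (\<lambda>i. c i * (norm (u (Complex t y)) * K))" by (intro summable_mult2 c)
      show "norm (norm (?f i t)) \<le> c i * (norm (u (Complex t y)) * K)" for i
        using c(2)[of i] K by (auto simp: norm_mult intro!: mult_left_mono)
    qed
    have "compact ((\<lambda>t. u (Complex t y)) ` {-(a+1)..a+1})"
      by (intro compact_continuous_image compact_Icc continuous_on_subset[OF uy[OF that]]) auto
    then obtain L where "\<And>v. v \<in> (\<lambda>t. u (Complex t y)) ` {-(a+1)..a+1} \<Longrightarrow> norm v \<le> L"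
      by (metis compact_imp_bounded bounded_iff)
    then have L: "\<And>t. t \<in> {-(a+1)..a+1} \<Longrightarrow> norm (u (Complex t y)) \<le> L" by blast
    have K0: "K \<ge> 0" using K[of 0] norm_ge_zero order_trans by blast
    have a0: "a \<ge> 0" using x[of 0] by linarith
    have L0: "L \<ge> 0" by (rule order_trans[OF norm_ge_zero L[of 0]]) (use a0 in simp)
    let ?I = "\<lambda>t. indicator {-(a+1)..a+1} t :: real"
    have iI: "integrable lborel ?I" by (rule integrable_real_indicator) (auto simp: emeasure_lborel_Icc_eq)
    have nb: "norm (u (Complex t y) * D 0 (t - x i)) \<le> L * K * ?I t" for t i
    proof (cases "t \<in> {-(a+1)..a+1}")
      case True
      then show ?thesis using L K L0 by (auto simp: norm_mult intro!: mult_mono)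
    next
      case False
      then have "D 0 (t - x i) = 0" using x[of i] by (intro D0(2)) auto
      then show ?thesis using K0 L0 by simp
    qed
    have "(LINT t|lborel. norm (?f i t)) \<le> c i * (L * K * (2 * (a + 1)))" for i
    proof -
      have "(LINT t|lborel. norm (u (Complex t y) * D 0 (t - x i))) \<le> (LINT t|lborel. L * K * ?I t)"
        by (intro integral_mono integrable_norm int that nb integrable_mult_right iI)
      also have "\<dots> = L * K * (2 * (a + 1))"
        using a0 by simp
      finally show ?thesis using c(2)[of i] by (simp add: norm_mult mult_left_mono)
    qed
    then have ism: "summable (\<lambda>i. LINT t|lborel. norm (?f i t))"
      by (intro summable_comparison_test'[OF summable_mult2[OF c(1)], of 0]) auto
    have "(LINT t|lborel. (\<Sum>i. ?f i t)) = (\<Sum>i. LINT t|lborel. ?f i t)"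
      by (rule integral_suminf) (use int[OF that] nsm ism in auto)
    also have "(\<lambda>i. LINT t|lborel. ?f i t) = (\<lambda>i. of_real (c i) * W (x i) y)"
      using W_eq[OF that] by simp
    also have "(\<lambda>t. \<Sum>i. ?f i t) = (\<lambda>t. u (Complex t y) * \<Psi> 0 t)"
    proof
      fix t
      have "summable (\<lambda>i. of_real (c i) * D 0 (t - x i))"
        by (rule summable_comparison_test'[OF summable_mult2[OF c(1), of K], of 0])
           (use c(2) K in \<open>auto simp: norm_mult intro!: mult_left_mono\<close>)
      from suminf_mult[OF this, of "u (Complex t y)"]
      show "(\<Sum>i. ?f i t) = u (Complex t y) * \<Psi> 0 t"
        by (simp add: \<Psi>_def mult_ac)
    qed
    finally show ?thesis .
  qed
  have "y \<longlonglongrightarrow> 0"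
    by (rule tendsto_sandwich[of "\<lambda>_. 0" _ _ "\<lambda>n. 1 / real (Suc n)"])
       (use y LIMSEQ_inverse_real_of_nat in \<open>auto simp: inverse_eq_divide less_imp_le\<close>)
  then have "filterlim y (at_right 0) sequentially"
    using y(1) by (intro filterlim_at_withinI) (auto simp: less_imp_neq[symmetric])
  then have "(\<lambda>n. LINT t|lborel. u (Complex t (y n)) * \<Psi> 0 t) \<longlonglongrightarrow> 0"
    using filterlim_compose[OF lim] by blast
  then have "(\<lambda>n. \<Sum>i. of_real (c i) * w i n) \<longlonglongrightarrow> 0"
    using y(1) by (simp add: lint w_def)
  from tendstoD[OF this, of 1]
  have "\<forall>\<^sub>F n in sequentially. norm (\<Sum>i. of_real (c i) * w i n) < 1" by simp
  then obtain n where n: "norm (\<Sum>i. of_real (c i) * w i n) < 1"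
    by (auto simp: eventually_sequentially)
  have "(1/4)^n * norm (w n n) / 6 \<le> norm (\<Sum>i. of_real (c i) * w i n)"
    unfolding c_def by (rule gliding_hump) (use mx x in \<open>auto simp: w_def\<close>)
  moreover have "(1/4)^n * norm (w n n) / 6 \<ge> (1/4)^n * (6 * 4^n) / 6"
    using big[of n] by (intro divide_right_mono mult_left_mono) (auto simp: w_def)
  moreover have "(1/4)^n * (6 * 4^n) / 6 = (1::real)"
    by (simp add: power_divide)
  ultimately show False using n by simp
qed

section \<open>Gluing across the real axis\<close>

text \<open>On the convex box over a bounded interval the derivative bound is a Lipschitz estimate,
  so values along a vertical approach form a Cauchy sequence and the estimate passes to the limits.
  The last conclusion identifies the boundary values for later comparison.\<close>

lemma bounded_deriv_continuous_extension:
  assumes f: "f holomorphic_on upper_half_plane"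
    and bd: "\<And>a. \<exists>M. \<forall>x y. \<bar>x\<bar> \<le> a \<and> 0 < y \<and> y \<le> 1 \<longrightarrow> norm (deriv f (Complex x y)) \<le> M"
  obtains g where "continuous_on {z. Im z \<ge> 0} g" "\<And>z. z \<in> upper_half_plane \<Longrightarrow> g z = f z"
    "\<And>x. (\<lambda>n. f (Complex x (1 / real (Suc n)))) \<longlonglongrightarrow> g (Complex x 0)"
proof -
  define h where "h = (\<lambda>(z::complex) n. z + Complex 0 (1 / real (Suc n)))"
  \<comment> \<open>One formula serves interior and boundary points: inside the half-plane the limit
    is \<open>f z\<close> by continuity.\<close>
  define g where "g = (\<lambda>z. lim (\<lambda>n. f (h z n)))"
  have Re_h [simp]: "Re (h z n) = Re z" and Im_h [simp]: "Im (h z n) = Im z + 1 / real (Suc n)" for z n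
    by (auto simp: h_def)
  have conv: "convex {z. \<bar>Re z\<bar> \<le> a \<and> 0 < Im z \<and> Im z \<le> 1}" for a
  proof -
    have "{z. \<bar>Re z\<bar> \<le> a \<and> 0 < Im z \<and> Im z \<le> 1} =
      {z. Re z \<le> a} \<inter> {z. Re z \<ge> - a} \<inter> {z. Im z > 0} \<inter> {z. Im z \<le> 1}" by auto
    then show ?thesis
      by (simp add: convex_Int convex_halfspace_Re_le convex_halfspace_Re_ge convex_halfspace_Im_gt convex_halfspace_Im_le)
  qed
  have lip: "\<exists>M\<ge>0. \<forall>z w. \<bar>Re z\<bar> \<le> a \<and> 0 < Im z \<and> Im z \<le> 1 \<and> \<bar>Re w\<bar> \<le> a \<and> 0 < Im w \<and> Im w \<le> 1 \<longrightarrow>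
     norm (f z - f w) \<le> M * norm (z - w)" for a
  proof -
    obtain M where M: "\<And>x y. \<bar>x\<bar> \<le> a \<Longrightarrow> 0 < y \<Longrightarrow> y \<le> 1 \<Longrightarrow> norm (deriv f (Complex x y)) \<le> M"
      using bd[of a] by blast
    let ?T = "{z. \<bar>Re z\<bar> \<le> a \<and> 0 < Im z \<and> Im z \<le> 1}"
    have "norm (f z - f w) \<le> max M 0 * norm (z - w)" if "z \<in> ?T" "w \<in> ?T" for z w
    proof (rule field_differentiable_bound[OF conv[of a] _ _ that])
      show "(f has_field_derivative deriv f z) (at z within ?T)" if "z \<in> ?T" for z
        using that holomorphic_derivI[OF f open_upper_half_plane] by (auto simp: upper_half_plane_def)
      show "norm (deriv f z) \<le> max M 0" if "z \<in> ?T" for z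
        using M[of "Re z" "Im z"] that by auto
    qed
    then show ?thesis by (intro exI[of _ "max M 0"]) auto
  qed
  have lim0: "(\<lambda>n. 1 / real (Suc n)) \<longlonglongrightarrow> 0"
    using LIMSEQ_inverse_real_of_nat by (simp add: inverse_eq_divide)
  have h_lim: "(\<lambda>n. h z n) \<longlonglongrightarrow> z" for z
  proof -
    have "(\<lambda>n. z + Complex 0 (1 / real (Suc n))) \<longlonglongrightarrow> z + Complex 0 0"
      unfolding Complex_eq by (intro tendsto_intros lim0)
    then show ?thesis unfolding h_def by (simp add: Complex_eq)
  qed
  have up: "(\<lambda>n. f (h z n)) \<longlonglongrightarrow> f z" if "z \<in> upper_half_plane" for z
    using holomorphic_on_imp_continuous_on[OF f] open_upper_half_plane that h_lim
    by (metis continuous_on_eq_continuous_at isCont_tendsto_compose)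
  then have g_up: "g z = f z" if "z \<in> upper_half_plane" for z
    unfolding g_def using that limI by blast
  have conv: "convergent (\<lambda>n. f (h z n))" if "Im z \<ge> 0" for z
  proof (cases "Im z = 0")
    case False
    then show ?thesis using up[of z] that by (auto simp: upper_half_plane_def convergent_def)
  next
    case True
    obtain M where M: "M \<ge> 0" "\<And>v w. \<bar>Re v\<bar> \<le> \<bar>Re z\<bar> \<Longrightarrow> 0 < Im v \<Longrightarrow> Im v \<le> 1 \<Longrightarrow> \<bar>Re w\<bar> \<le> \<bar>Re z\<bar> \<Longrightarrow> 0 < Im w \<Longrightarrow> Im w \<le> 1 \<Longrightarrow>
     norm (f v - f w) \<le> M * norm (v - w)" using lip[of "\<bar>Re z\<bar>"] by blast
    have "Cauchy (\<lambda>n. f (h z n))"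
    proof (rule metric_CauchyI)
      fix e :: real assume "e > 0"
      have "Cauchy (h z)" using h_lim LIMSEQ_imp_Cauchy by blast
      then obtain N where N: "\<And>m n. m \<ge> N \<Longrightarrow> n \<ge> N \<Longrightarrow> dist (h z m) (h z n) < e / (M + 1)"
        using \<open>e > 0\<close> M(1) unfolding Cauchy_def by (meson add_nonneg_pos divide_pos_pos zero_less_one)
      have "dist (f (h z m)) (f (h z n)) < e" if "m \<ge> N" "n \<ge> N" for m n
      proof -
        have "dist (f (h z m)) (f (h z n)) \<le> M * dist (h z m) (h z n)"
          unfolding dist_norm using True by (intro M) auto
        also have "\<dots> \<le> (M + 1) * dist (h z m) (h z n)" by (intro mult_right_mono) auto
        also have "\<dots> < e" using N[OF that] M(1) by (simp add: field_simps)
        finally show ?thesis .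
      qed
      then show "\<exists>N. \<forall>m\<ge>N. \<forall>n\<ge>N. dist (f (h z m)) (f (h z n)) < e" by blast
    qed
    then show ?thesis by (rule Cauchy_convergent)
  qed
  then have g_lim: "(\<lambda>n. f (h z n)) \<longlonglongrightarrow> g z" if "Im z \<ge> 0" for z
    using that convergent_LIMSEQ_iff unfolding g_def by blast
  show thesis
  proof (rule that)
    show "g z = f z" if "z \<in> upper_half_plane" for z by (rule g_up[OF that])
    show "(\<lambda>n. f (Complex x (1 / real (Suc n)))) \<longlonglongrightarrow> g (Complex x 0)" for x
      using g_lim[of "Complex x 0"] by (simp add: h_def Complex_eq)
    show "continuous_on {z. Im z \<ge> 0} g"
      unfolding continuous_on_iff
    proof (intro ballI allI impI)
      fix z :: complex and e :: real assume z: "z \<in> {z. Im z \<ge> 0}" and "e > 0"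
      show "\<exists>d>0. \<forall>w\<in>{z. Im z \<ge> 0}. dist w z < d \<longrightarrow> dist (g w) (g z) < e"
      proof (cases "Im z = 0")
        case False
        then have zH: "z \<in> upper_half_plane" using z by (auto simp: upper_half_plane_def)
        have "continuous_on upper_half_plane g"
          using holomorphic_on_imp_continuous_on[OF f] g_up by (simp cong: continuous_on_cong)
        then have "isCont g z"
          using zH open_upper_half_plane continuous_on_eq_continuous_at by blast
        then show ?thesis using \<open>e > 0\<close> unfolding continuous_at_eps_delta by blast
      next
        case True
        let ?a = "\<bar>Re z\<bar> + 1"
        obtain M where M: "M \<ge> 0" "\<And>v w. \<bar>Re v\<bar> \<le> ?a \<Longrightarrow> 0 < Im v \<Longrightarrow> Im v \<le> 1 \<Longrightarrow> \<bar>Re w\<bar> \<le> ?a \<Longrightarrow> 0 < Im w \<Longrightarrow> Im w \<le> 1 \<Longrightarrow>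
            norm (f v - f w) \<le> M * norm (v - w)" using lip[of ?a] by blast
        \<comment> \<open>Radius \<open>1/2\<close>, combined with shifts of at most
          \<open>1/2\<close> for \<open>n \<ge> 1\<close>, keeps the shifted points at height at
          most 1, where the Lipschitz estimate holds.\<close>
        have gl: "norm (g w - g z) \<le> M * norm (w - z)" if w: "Im w \<ge> 0" "norm (w - z) \<le> 1/2" for w
        proof (rule LIMSEQ_le)
          show "(\<lambda>n. norm (f (h w n) - f (h z n))) \<longlonglongrightarrow> norm (g w - g z)"
            using w z by (intro tendsto_intros g_lim) auto
          show "(\<lambda>n. M * norm (h w n - h z n)) \<longlonglongrightarrow> M * norm (w - z)"
            by (intro tendsto_intros h_lim)
          have "\<bar>Im (w - z)\<bar> \<le> 1/2" "\<bar>Re (w - z)\<bar> \<le> 1/2"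
            using w abs_Im_le_cmod[of "w - z"] abs_Re_le_cmod[of "w - z"] by auto
          then have w': "Im w \<le> 1/2" "\<bar>Re w\<bar> \<le> ?a"
            using True abs_triangle_ineq2[of "Re w" "Re z"] by auto
          have "norm (f (h w n) - f (h z n)) \<le> M * norm (h w n - h z n)" if "n \<ge> 1" for n
          proof (rule M)
            have "1 / real (Suc n) \<le> 1/2" using that by (intro divide_left_mono) auto
            then show "Im (h w n) \<le> 1" "Im (h z n) \<le> 1" unfolding Im_h using w' True by linarith+
          qed (use w w' True in \<open>auto intro: add_nonneg_pos\<close>)
          then show "\<exists>N. \<forall>n\<ge>N. norm (f (h w n) - f (h z n)) \<le> M * norm (h w n - h z n)" by blast
        qed
        have "dist (g w) (g z) < e" if "Im w \<ge> 0" "dist w z < min (1/2) (e / (M + 1))" for w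
        proof -
          have "dist (g w) (g z) \<le> M * dist w z" using gl[of w] that by (auto simp: dist_norm)
          also have "\<dots> \<le> (M + 1) * dist w z" by (intro mult_right_mono) auto
          also have "\<dots> < e" using that M(1) by (simp add: field_simps)
          finally show ?thesis .
        qed
        moreover have "min (1/2) (e / (M + 1)) > 0" using \<open>e > 0\<close> M(1) by simp
        ultimately show ?thesis by blast
      qed
    qed
  qed
qed


lemma cnj_upper_half_plane: "cnj ` upper_half_plane = {z. Im z < 0}"
proof -
  have "z \<in> cnj ` upper_half_plane" if "Im z < 0" for z
    using that by (intro image_eqI[of _ _ "cnj z"]) (auto simp: upper_half_plane_def)
  then show ?thesis by (auto simp: upper_half_plane_def)
qed

text \<open>The hypotheses on the sums control \<open>A' - B' \<circ> cnj\<close> by integrating its vertical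
  derivative \<open>\<i> (A'' + B'' \<circ> cnj)\<close> down from \<open>Im z = 1\<close>, hence \<open>A'\<close> and \<open>B'\<close> separately, so
  that \<open>A\<close> and \<open>- B\<close> extend continuously to the real axis, where they agree.\<close>

lemma glue_across_real_axis:
  fixes A A' A'' B B' B'' :: "complex \<Rightarrow> complex"
  assumes A: "\<And>z. Im z > 0 \<Longrightarrow> (A has_field_derivative A' z) (at z)"
      "\<And>z. Im z > 0 \<Longrightarrow> (A' has_field_derivative A'' z) (at z)"
    and B: "\<And>z. Im z < 0 \<Longrightarrow> (B has_field_derivative B' z) (at z)"
      "\<And>z. Im z < 0 \<Longrightarrow> (B' has_field_derivative B'' z) (at z)"
    and bd': "\<And>a. \<exists>M. \<forall>x y. \<bar>x\<bar> \<le> a \<and> 0 < y \<and> y \<le> 1 \<longrightarrow>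
      norm (A' (Complex x y) + B' (Complex x (- y))) \<le> M"
    and bd'': "\<And>a. \<exists>M. \<forall>x y. \<bar>x\<bar> \<le> a \<and> 0 < y \<and> y \<le> 1 \<longrightarrow>
      norm (A'' (Complex x y) + B'' (Complex x (- y))) \<le> M"
    and lim: "\<And>x. ((\<lambda>y. A (Complex x y) + B (Complex x (- y))) \<longlongrightarrow> 0) (at_right 0)"
  obtains P where "P holomorphic_on UNIV" "\<And>z. Im z > 0 \<Longrightarrow> P z = A z" "\<And>z. Im z < 0 \<Longrightarrow> P z = - B z"
proof -
  have cA': "continuous_on {z. Im z > 0} A'" and cB': "continuous_on {z. Im z < 0} B'"
    using A(2) B(2) by (auto intro!: continuous_at_imp_continuous_on DERIV_isCont)
  have Cd: "((\<lambda>y. Complex x y) has_vector_derivative \<i>) (at y)"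
    "((\<lambda>y. Complex x (- y)) has_vector_derivative - \<i>) (at y)" for x y
    unfolding Complex_eq by (auto intro!: derivative_eq_intros has_vector_derivative_real_field)
  have bound: "\<exists>M. \<forall>x y. \<bar>x\<bar> \<le> a \<and> 0 < y \<and> y \<le> 1 \<longrightarrow>
      norm (A' (Complex x y)) \<le> M \<and> norm (B' (Complex x (- y))) \<le> M" for a
  proof -
    let ?d = "\<lambda>x y. A' (Complex x y) - B' (Complex x (- y))"
    obtain M1 where M1: "\<And>x y. \<bar>x\<bar> \<le> a \<Longrightarrow> 0 < y \<Longrightarrow> y \<le> 1 \<Longrightarrow> norm (A' (Complex x y) + B' (Complex x (- y))) \<le> M1"
      using bd'[of a] by blast
    obtain M2 where M2: "\<And>x y. \<bar>x\<bar> \<le> a \<Longrightarrow> 0 < y \<Longrightarrow> y \<le> 1 \<Longrightarrow> norm (A'' (Complex x y) + B'' (Complex x (- y))) \<le> M2"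
      using bd''[of a] by blast
    \<comment> \<open>Height 1 lies away from the axis, so compactness bounds the starting values of
      the vertical integration.\<close>
    have "continuous_on {-a..a} (\<lambda>x. ?d x 1)"
      by (intro continuous_intros continuous_on_compose2[OF cA'] continuous_on_compose2[OF cB'])
         (auto simp: Complex_eq intro!: continuous_intros)
    then have "compact ((\<lambda>x. ?d x 1) ` {-a..a})" by (intro compact_continuous_image compact_Icc)
    then obtain K where "\<And>v. v \<in> (\<lambda>x. ?d x 1) ` {-a..a} \<Longrightarrow> norm v \<le> K"
      by (metis compact_imp_bounded bounded_iff)
    then have K: "\<And>x. \<bar>x\<bar> \<le> a \<Longrightarrow> norm (?d x 1) \<le> K" by (auto simp: abs_le_iff)
    have d: "norm (?d x y) \<le> K + M2" if x: "\<bar>x\<bar> \<le> a" and y: "0 < y" "y \<le> 1" for x y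
    proof -
      have "norm (?d x y - ?d x 1) \<le> M2 * norm (y - 1)"
      proof (rule differentiable_bound[where S = "{y..1}" and f' = "\<lambda>s h. h *\<^sub>R (\<i> * (A'' (Complex x s) + B'' (Complex x (- s))))"])
        fix s assume s: "s \<in> {y..1}"
        then have pos: "s > 0" using y by auto
        have "((\<lambda>s. A' (Complex x s)) has_vector_derivative \<i> * A'' (Complex x s)) (at s)"
          using field_vector_diff_chain_at[OF Cd(1) A(2), of x s] pos by (simp add: o_def)
        moreover have "((\<lambda>s. B' (Complex x (- s))) has_vector_derivative - \<i> * B'' (Complex x (- s))) (at s)"
          using field_vector_diff_chain_at[OF Cd(2) B(2), of x s] pos by (simp add: o_def)
        ultimately have "((\<lambda>s. ?d x s) has_vector_derivative \<i> * A'' (Complex x s) - - \<i> * B'' (Complex x (- s))) (at s)"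
          by (rule has_vector_derivative_diff)
        then have "((\<lambda>s. ?d x s) has_vector_derivative \<i> * (A'' (Complex x s) + B'' (Complex x (- s)))) (at s)"
          by (simp add: algebra_simps)
        then show "((\<lambda>s. ?d x s) has_derivative (\<lambda>h. h *\<^sub>R (\<i> * (A'' (Complex x s) + B'' (Complex x (- s))))))
            (at s within {y..1})"
          by (auto simp: has_vector_derivative_def intro: has_derivative_at_withinI)
        show "onorm (\<lambda>h. h *\<^sub>R (\<i> * (A'' (Complex x s) + B'' (Complex x (- s))))) \<le> M2"
        proof (rule onorm_le)
          fix h :: real
          have "norm (A'' (Complex x s) + B'' (Complex x (- s))) \<le> M2"
            using M2[OF x pos] s by simp
          then show "norm (h *\<^sub>R (\<i> * (A'' (Complex x s) + B'' (Complex x (- s))))) \<le> M2 * norm h"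
            by (simp add: norm_mult mult.commute[of M2] mult_left_mono)
        qed
      qed (use y in auto)
      moreover have "M2 * norm (y - 1) \<le> M2"
      proof -
        have "M2 \<ge> 0" using M2[OF x y] norm_ge_zero order_trans by blast
        then show ?thesis using y by (simp add: mult_left_le)
      qed
      moreover have "norm (?d x y) \<le> norm (?d x y - ?d x 1) + norm (?d x 1)"
        using norm_triangle_ineq[of "?d x y - ?d x 1" "?d x 1"] by simp
      ultimately show ?thesis using K[OF x] by linarith
    qed
    have "norm (A' (Complex x y)) \<le> M1 + (K + M2) \<and> norm (B' (Complex x (- y))) \<le> M1 + (K + M2)"
      if "\<bar>x\<bar> \<le> a" "0 < y" "y \<le> 1" for x y
    proof -
      let ?p = "A' (Complex x y)" and ?q = "B' (Complex x (- y))"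
      have "2 * norm ?p = norm ((?p + ?q) + (?p - ?q))"
        unfolding norm_mult[of 2, symmetric, simplified] by (simp add: norm_mult)
      moreover have "2 * norm ?q = norm ((?p + ?q) - (?p - ?q))"
        by (simp add: norm_mult)
      ultimately have "2 * norm ?p \<le> norm (?p + ?q) + norm (?p - ?q)" "2 * norm ?q \<le> norm (?p + ?q) + norm (?p - ?q)"
        by (metis norm_triangle_ineq, metis norm_triangle_ineq4)
      then show ?thesis
        using M1[OF that] d[OF that] norm_ge_zero[of ?p] norm_ge_zero[of ?q] by linarith
    qed
    then show ?thesis by blast
  qed
  have H: "upper_half_plane = {z. Im z > 0}" by (simp add: upper_half_plane_def)
  have Ahol: "A holomorphic_on upper_half_plane"
    using A(1) open_halfspace_Im_gt[of 0] by (auto simp: holomorphic_on_open H)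
  \<comment> \<open>The point reflection carries the lower half-plane to the upper one, so the same
    extension lemma serves \<open>B\<close>. The outer sign makes \<open>Bm (- z)\<close> equal to
    \<open>- B z\<close>, the intended lower half of \<open>P\<close>.\<close>
  define Bm where "Bm = (\<lambda>z. - B (- z))"
  have Bm: "(Bm has_field_derivative B' (- z)) (at z)" if "Im z > 0" for z
  proof -
    have "(B has_field_derivative B' (- z)) (at (- z))" using B(1)[of "- z"] that by simp
    then have "((\<lambda>z. B (- z)) has_field_derivative B' (- z) * (- 1)) (at z)"
      by (intro DERIV_chain2) (auto intro!: derivative_eq_intros)
    then show ?thesis unfolding Bm_def by (auto intro!: derivative_eq_intros)
  qed
  have Bhol: "Bm holomorphic_on upper_half_plane"
    using Bm open_halfspace_Im_gt[of 0] by (auto simp: holomorphic_on_open H)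
  have "\<exists>M. \<forall>x y. \<bar>x\<bar> \<le> a \<and> 0 < y \<and> y \<le> 1 \<longrightarrow> norm (deriv A (Complex x y)) \<le> M" for a
  proof -
    have "deriv A (Complex x y) = A' (Complex x y)" if "y > 0" for x y
      by (rule DERIV_imp_deriv[OF A(1)]) (use that in simp)
    then show ?thesis using bound[of a] by metis
  qed
  then obtain gA where gA: "continuous_on {z. Im z \<ge> 0} gA" "\<And>z. z \<in> upper_half_plane \<Longrightarrow> gA z = A z"
      "\<And>x. (\<lambda>n. A (Complex x (1 / real (Suc n)))) \<longlonglongrightarrow> gA (Complex x 0)"
    using bounded_deriv_continuous_extension[OF Ahol] by blast
  have "\<exists>M. \<forall>x y. \<bar>x\<bar> \<le> a \<and> 0 < y \<and> y \<le> 1 \<longrightarrow> norm (deriv Bm (Complex x y)) \<le> M" for a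
  proof -
    have "deriv Bm (Complex x y) = B' (Complex (- x) (- y))" if "y > 0" for x y
      using DERIV_imp_deriv[OF Bm[of "Complex x y"]] that
      by (simp add: Complex_eq)
    moreover have "\<exists>M. \<forall>x y. \<bar>x\<bar> \<le> a \<and> 0 < y \<and> y \<le> 1 \<longrightarrow> norm (B' (Complex (- x) (- y))) \<le> M"
      using bound[of a] by (metis abs_minus_cancel)
    ultimately show ?thesis by metis
  qed
  then obtain gB where gB: "continuous_on {z. Im z \<ge> 0} gB" "\<And>z. z \<in> upper_half_plane \<Longrightarrow> gB z = Bm z"
      "\<And>x. (\<lambda>n. Bm (Complex x (1 / real (Suc n)))) \<longlonglongrightarrow> gB (Complex x 0)"
    using bounded_deriv_continuous_extension[OF Bhol] by blast
  \<comment> \<open>The extensions exist already, so a single sequence tending to each real point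
    suffices to compare them.\<close>
  have agree: "gA z = gB (- z)" if "Im z = 0" for z
  proof -
    let ?x = "Re z"
    have z: "z = Complex ?x 0" "- z = Complex (- ?x) 0" using that by (auto simp: complex_eq_iff)
    have "filterlim (\<lambda>n. 1 / real (Suc n)) (at_right 0) sequentially"
      using LIMSEQ_inverse_real_of_nat
      by (intro filterlim_at_withinI) (auto simp: inverse_eq_divide)
    from filterlim_compose[OF lim this]
    have "(\<lambda>n. A (Complex ?x (1 / real (Suc n))) + B (Complex ?x (- (1 / real (Suc n))))) \<longlonglongrightarrow> 0" .
    moreover have "(\<lambda>n. A (Complex ?x (1 / real (Suc n))) - Bm (Complex (- ?x) (1 / real (Suc n)))) \<longlonglongrightarrow> gA z - gB (- z)"
      unfolding z(2) by (subst z(1)) (intro tendsto_intros gA gB)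
    moreover have "- Bm (Complex (- x) y) = B (Complex x (- y))" for x y
      by (simp add: Bm_def Complex_eq)
    ultimately have "gA z - gB (- z) = 0"
      by (metis (no_types, lifting) LIMSEQ_unique diff_conv_add_uminus ext)
    then show ?thesis by simp
  qed
  define P where "P = (\<lambda>z. if Im z \<ge> 0 then gA z else gB (- z))"
  have Pup: "P z = A z" if "Im z > 0" for z using that gA(2) by (simp add: P_def H)
  have Plow: "P z = - B z" if "Im z < 0" for z using that gB(2) by (simp add: P_def H Bm_def)
  have "continuous_on ({z. Im z \<ge> 0} \<union> {z. Im z \<le> 0}) P"
    unfolding P_def
  proof (rule continuous_on_cases)
    show "continuous_on {z. Im z \<le> 0} (\<lambda>z. gB (- z))"
      by (rule continuous_on_compose2[OF gB(1)]) (auto intro!: continuous_intros)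
  qed (use agree in \<open>auto intro: gA closed_halfspace_Im_ge closed_halfspace_Im_le\<close>)
  moreover have "{z. Im z \<ge> 0} \<union> {z. Im z \<le> 0} = UNIV" by auto
  ultimately have Pc: "continuous_on UNIV P" by simp
  have "P holomorphic_on UNIV"
  proof (rule holomorphic_on_paste_across_line[of _ "\<i>" P 0])
    have "(P has_field_derivative A' z) (at z)" if "Im z > 0" for z
      by (rule has_field_derivative_transform_within_open[OF A(1)[OF that] open_halfspace_Im_gt[of 0]])
        (use that Pup in auto)
    then show "P holomorphic_on UNIV \<inter> {z. 0 < \<i> \<bullet> z}"
      using open_halfspace_Im_gt[of 0] by (auto simp: holomorphic_on_open)
    have "(P has_field_derivative - B' z) (at z)" if "Im z < 0" for z
      by (rule has_field_derivative_transform_within_open[OF DERIV_minus[OF B(1)[OF that]] open_halfspace_Im_lt[of 0]])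
        (use that Plow in auto)
    then show "P holomorphic_on UNIV \<inter> {z. \<i> \<bullet> z < 0}"
      using open_halfspace_Im_lt[of 0] by (auto simp: holomorphic_on_open)
  qed (use Pc in auto)
  then show thesis using that Pup Plow by blast
qed

section \<open>Entire functions of temperate growth\<close>

text \<open>Coefficients are peeled off from the top. Divided by \<open>t ^ N\<close>, the
  polynomial tends to its leading coefficient, while for \<open>n \<le> N\<close> the hypothesis
  forces this quotient to 0.\<close>

lemma coeffs_zero_of_growth:
  fixes a :: "nat \<Rightarrow> complex"
  assumes "((\<lambda>t::real. (\<Sum>k\<le>N. a k * of_real t ^ k) / of_real t ^ n) \<longlongrightarrow> 0) at_top"
    and "n \<le> k" "k \<le> N"
  shows "a k = 0"
proof -
  have inv: "((\<lambda>t::real. inverse (of_real t) :: complex) \<longlongrightarrow> 0) at_top"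
    using tendsto_of_real[OF tendsto_inverse_0_at_top[OF filterlim_ident], where 'a = complex] by simp
  have top: "a N = 0"
    if f: "((\<lambda>t::real. (\<Sum>k\<le>N. a k * of_real t ^ k) / of_real t ^ n) \<longlongrightarrow> 0) at_top" and "n \<le> N" for N
  proof -
    have "((\<lambda>t::real. \<Sum>k\<le>N. a k * inverse (of_real t) ^ (N - k)) \<longlongrightarrow> (\<Sum>k\<le>N. a k * 0 ^ (N - k))) at_top"
      by (intro tendsto_intros inv)
    \<comment> \<open>Here \<open>0 ^ 0 = 1\<close>, so exactly the top coefficient
      survives.\<close>
    also have "(\<Sum>k\<le>N. a k * 0 ^ (N - k)) = (\<Sum>k\<le>N. if k = N then a k else 0)"
      by (intro sum.cong) auto
    finally have l1: "((\<lambda>t::real. \<Sum>k\<le>N. a k * inverse (of_real t) ^ (N - k)) \<longlongrightarrow> a N) at_top"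
      by simp
    have l2: "((\<lambda>t::real. (\<Sum>k\<le>N. a k * of_real t ^ k) / of_real t ^ n * inverse (of_real t) ^ (N - n)) \<longlongrightarrow> 0) at_top"
      using tendsto_mult[OF f tendsto_power[OF inv, of "N - n"]] by simp
    have "\<forall>\<^sub>F t in at_top. (\<Sum>k\<le>N. a k * of_real t ^ k) / of_real t ^ n * inverse (of_real t) ^ (N - n) =
      (\<Sum>k\<le>N. a k * inverse (of_real t) ^ (N - k))"
      using eventually_gt_at_top[of "0::real"]
    proof eventually_elim
      case (elim t)
      have pw: "(of_real t :: complex) ^ N = of_real t ^ k * of_real t ^ (N - k)" if "k \<le> N" for k
        using that by (simp add: power_add[symmetric])
      have "(\<Sum>k\<le>N. a k * of_real t ^ k) / of_real t ^ n * inverse (of_real t) ^ (N - n) =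
         (\<Sum>k\<le>N. a k * of_real t ^ k) / of_real t ^ N"
        using elim by (simp add: pw[OF \<open>n \<le> N\<close>] field_simps)
      also have "\<dots> = (\<Sum>k\<le>N. a k * inverse (of_real t) ^ (N - k))"
        unfolding sum_divide_distrib
        by (intro sum.cong refl) (use elim in \<open>simp add: pw field_simps\<close>)
      finally show ?case .
    qed
    with l2 have "((\<lambda>t::real. \<Sum>k\<le>N. a k * inverse (of_real t) ^ (N - k)) \<longlongrightarrow> 0) at_top"
      by (rule Lim_transform_eventually)
    with l1 show ?thesis using tendsto_unique trivial_limit_at_top_linorder by blast
  qed
  show ?thesis
    using assms
  proof (induction N)
    case 0
    then have "n \<le> 0" "k = 0" by linarith+
    then show ?case using top[OF "0.prems"(1)] by blast
  next
    case (Suc N)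
    have "n \<le> Suc N" using Suc.prems(2,3) by (rule order_trans)
    then have "a (Suc N) = 0" by (rule top[OF Suc.prems(1)])
    with Suc.prems(1) have "((\<lambda>t::real. (\<Sum>k\<le>N. a k * of_real t ^ k) / of_real t ^ n) \<longlongrightarrow> 0) at_top"
      by simp
    then show ?case
      using Suc.IH Suc.prems(2,3) \<open>a (Suc N) = 0\<close> by (metis le_Suc_eq)
  qed
qed

section \<open>Fourier coefficients of entire functions on circles\<close>

lemma has_integral_circle:
  assumes "((\<lambda>z. g z / z) has_contour_integral I) (circlepath 0 r)" and "r > 0"
  shows "((\<lambda>t. g (of_real r * cis t)) has_integral I / \<i>) {0..2*pi}"
proof -
  have "((\<lambda>t. g (of_real r * cis t) / (of_real r * cis t) * of_real r * \<i> * cis t) has_integral I) {0..2*pi}"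
    using assms(1) unfolding circlepath_def
    by (subst (asm) has_contour_integral_part_circlepath_iff) auto
  from has_integral_divide[OF this, of \<i>] show ?thesis
    using \<open>r > 0\<close> by (simp add: field_simps)
qed

lemma circle_coefficient:
  assumes P: "P holomorphic_on UNIV" and "r > 0"
  shows "((\<lambda>t. P (of_real r * cis t) / (of_real r * cis t) ^ l) has_integral
     2 * of_real pi * ((deriv ^^ l) P 0 / fact l)) {0..2*pi}"
proof -
  have "((\<lambda>u. P u / (u - 0) ^ Suc l) has_contour_integral (2 * pi * \<i>) / fact l * (deriv ^^ l) P 0) (circlepath 0 r)"
    by (rule Cauchy_has_contour_integral_higher_derivative_circlepath)
       (use assms in \<open>auto intro: holomorphic_on_subset holomorphic_on_imp_continuous_on\<close>)
  then have "((\<lambda>u. (P u / u ^ l) / u) has_contour_integral (2 * pi * \<i>) / fact l * (deriv ^^ l) P 0) (circlepath 0 r)"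
    by (simp add: field_simps)
  from has_integral_circle[OF this \<open>r > 0\<close>] show ?thesis by (simp add: field_simps)
qed

text \<open>On a circle \<open>P (cnj z)\<close> has no positive frequencies. After conjugation this
  is Cauchy's formula at 0 for the entire function \<open>cnj (P (cnj z)) * z ^ l\<close>, which
  vanishes there; dividing by \<open>r ^ (2 * l)\<close> turns \<open>cnj z ^ l\<close> into
  \<open>1 / z ^ l\<close>.\<close>

lemma circle_coefficient_cnj:
  assumes P: "P holomorphic_on UNIV" and "r > 0" "l > 0"
  shows "((\<lambda>t. P (cnj (of_real r * cis t)) / (of_real r * cis t) ^ l) has_integral 0) {0..2*pi}"
proof -
  let ?Q = "\<lambda>z. cnj (P (cnj z)) * z ^ l"
  have Q: "?Q holomorphic_on UNIV"
  proof -
    have "cnj \<circ> P \<circ> cnj holomorphic_on UNIV"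
      by (intro holomorphic_on_compose_cnj_cnj holomorphic_on_subset[OF P]) auto
    then show ?thesis by (intro holomorphic_intros) (simp add: o_def)
  qed
  have "((\<lambda>u. ?Q u / (u - 0) ^ Suc 0) has_contour_integral (2 * pi * \<i>) / fact 0 * (deriv ^^ 0) ?Q 0) (circlepath 0 r)"
    by (rule Cauchy_has_contour_integral_higher_derivative_circlepath)
       (use assms Q in \<open>auto intro!: holomorphic_on_subset[OF Q] holomorphic_on_imp_continuous_on\<close>)
  then have "((\<lambda>u. ?Q u / u) has_contour_integral 0) (circlepath 0 r)"
    using \<open>l > 0\<close> by (simp add: zero_power)
  from has_integral_circle[OF this \<open>r > 0\<close>]
  have "((\<lambda>t. ?Q (of_real r * cis t)) has_integral 0) {0..2*pi}" by simp
  then have "((\<lambda>t. cnj (?Q (of_real r * cis t)) / of_real r ^ (2 * l)) has_integral cnj 0 / of_real r ^ (2 * l)) {0..2*pi}"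
    by (intro has_integral_divide) (subst has_integral_cnj[symmetric], simp add: o_def)
  moreover have "cnj (?Q (of_real r * cis t)) / of_real r ^ (2 * l) =
     P (cnj (of_real r * cis t)) / (of_real r * cis t) ^ l" for t
  proof -
    have "cnj (of_real r * cis t) * (of_real r * cis t) = of_real r ^ 2"
      by (simp add: cis_cnj power2_eq_square mult_ac cis_mult)
    then have "cnj (of_real r * cis t) ^ l * (of_real r * cis t) ^ l = of_real r ^ (2 * l)"
      by (metis power_mult power_mult_distrib)
    then show ?thesis using \<open>r > 0\<close> by (simp add: field_simps)
  qed
  ultimately show ?thesis by simp
qed

text \<open>The weight \<open>(z\<^sup>2 - r\<^sup>2)\<^sup>M = (2 \<i> z Im z)\<^sup>M\<close> on the circle \<open>norm z = r\<close> compensates the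
  blow-up of the growth bound near the real axis.\<close>

lemma weighted_circle_integral:
  assumes P: "P holomorphic_on UNIV" and r: "r > 0" and "l > 0"
  shows "((\<lambda>t. (P (of_real r * cis t) - P (cnj (of_real r * cis t))) *
      ((of_real r * cis t)\<^sup>2 - of_real r ^ 2) ^ M / (of_real r * cis t) ^ (l + 2 * M)) has_integral
     (\<Sum>k\<le>M. of_nat (M choose k) * (- 1) ^ k * (2 * of_real pi * ((deriv ^^ (l + 2 * k)) P 0 / fact (l + 2 * k)))
        * of_real (r\<^sup>2) ^ k)) {0..2*pi}"
proof -
  let ?b = "\<lambda>l. 2 * of_real pi * ((deriv ^^ l) P 0 / fact l)"
  \<comment> \<open>Binomial expansion of the weight leaves Fourier coefficients of the positive
    indices \<open>l + 2 * k\<close>, to which the reflected function contributes nothing. The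
    result is a polynomial in \<open>r\<^sup>2\<close> whose constant term contains the
    \<open>l\<close>-th Taylor coefficient.\<close>
  have I: "((\<lambda>t. \<Sum>k\<le>M. of_nat (M choose k) * (- (of_real r)\<^sup>2) ^ k *
      (P (of_real r * cis t) / (of_real r * cis t) ^ (l + 2 * k) -
       P (cnj (of_real r * cis t)) / (of_real r * cis t) ^ (l + 2 * k))) has_integral
     (\<Sum>k\<le>M. of_nat (M choose k) * (- (of_real r)\<^sup>2) ^ k * (?b (l + 2 * k) - 0))) {0..2*pi}"
    by (intro has_integral_sum has_integral_mult_right has_integral_diff circle_coefficient
          circle_coefficient_cnj P r) (use \<open>l > 0\<close> in auto)
  have integrand: "(\<Sum>k\<le>M. of_nat (M choose k) * (- (of_real r)\<^sup>2) ^ k *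
      (P z / z ^ (l + 2 * k) - P (cnj z) / z ^ (l + 2 * k))) =
     (P z - P (cnj z)) * (z\<^sup>2 - of_real r ^ 2) ^ M / z ^ (l + 2 * M)" if "z \<noteq> 0" for z
  proof -
    have "(z\<^sup>2 - of_real r ^ 2) ^ M = (\<Sum>k\<le>M. of_nat (M choose k) * (- (of_real r)\<^sup>2) ^ k * (z\<^sup>2) ^ (M - k))"
      using binomial_ring[of "- (of_real r)\<^sup>2" "z\<^sup>2" M] by simp
    then have "(P z - P (cnj z)) * (z\<^sup>2 - of_real r ^ 2) ^ M / z ^ (l + 2 * M) =
       (\<Sum>k\<le>M. (P z - P (cnj z)) * (of_nat (M choose k) * (- (of_real r)\<^sup>2) ^ k * (z\<^sup>2) ^ (M - k)) / z ^ (l + 2 * M))"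
      by (simp add: sum_distrib_left sum_divide_distrib)
    also have "\<dots> = (\<Sum>k\<le>M. of_nat (M choose k) * (- (of_real r)\<^sup>2) ^ k *
      (P z / z ^ (l + 2 * k) - P (cnj z) / z ^ (l + 2 * k)))"
    proof (intro sum.cong refl)
      fix k assume "k \<in> {..M}"
      then have "l + 2 * M = (l + 2 * k) + 2 * (M - k)" by auto
      then have "z ^ (l + 2 * M) = z ^ (l + 2 * k) * (z\<^sup>2) ^ (M - k)"
        by (metis power_add power_mult)
      then show "(P z - P (cnj z)) * (of_nat (M choose k) * (- (of_real r)\<^sup>2) ^ k * (z\<^sup>2) ^ (M - k)) / z ^ (l + 2 * M)
         = of_nat (M choose k) * (- (of_real r)\<^sup>2) ^ k * (P z / z ^ (l + 2 * k) - P (cnj z) / z ^ (l + 2 * k))"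
        using that by (simp add: field_simps)
    qed
    finally show ?thesis by simp
  qed
  have nz: "of_real r * cis t \<noteq> 0" for t using r by simp
  have val: "(\<Sum>k\<le>M. of_nat (M choose k) * (- (of_real r)\<^sup>2) ^ k * (?b (l + 2 * k) - 0)) =
    (\<Sum>k\<le>M. of_nat (M choose k) * (- 1) ^ k * ?b (l + 2 * k) * of_real (r\<^sup>2) ^ k)"
    by (intro sum.cong refl) (simp add: power_minus[of "(of_real r)\<^sup>2"] mult_ac)
  show ?thesis
    using I unfolding integrand[OF nz] val .
qed

text \<open>On the circle of radius \<open>r\<close> the weight cancels the powers of
  \<open>Im z\<close> in the growth bound, leaving an integrand of size at most a constant times
  \<open>r ^ M / r ^ l\<close>. For \<open>l > M\<close> the weighted integral tends to 0; being a
  polynomial in \<open>r\<^sup>2\<close> it vanishes identically, and its constant term gives the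
  vanishing of the \<open>l\<close>-th Taylor coefficient.\<close>

lemma entire_temperate_imp_polynomial:
  assumes P: "P holomorphic_on UNIV"
    and bd: "\<And>z. norm z > R \<Longrightarrow> Im z > 0 \<Longrightarrow> norm (P z - P (cnj z)) \<le> C * ((norm z)\<^sup>2 / Im z) ^ M"
  shows "P z = (\<Sum>k\<le>M. (deriv ^^ k) P 0 / fact k * z ^ k)"
proof -
  let ?b = "\<lambda>k. (deriv ^^ k) P 0 / fact k"
  have zero: "?b l = 0" if "l > M" for l
  proof -
    define a where "a = (\<lambda>k. of_nat (M choose k) * (- 1) ^ k * (2 * of_real pi * ?b (l + 2 * k)))"
    have pt: "norm ((P z - P (cnj z)) * (z\<^sup>2 - of_real r ^ 2) ^ M / z ^ (l + 2 * M)) \<le> \<bar>C\<bar> * 2 ^ M / r"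
      if z: "norm z = r" and r: "r > max R 1" for z r
    proof -
      have r1: "r > 1" "r > R" using r by auto
      have "z * cnj z = of_real (r\<^sup>2)" using complex_norm_square[of z] z by simp
      then have "z\<^sup>2 - of_real r ^ 2 = z * (z - cnj z)" by (simp add: power2_eq_square algebra_simps)
      then have w: "norm (z\<^sup>2 - of_real r ^ 2) = 2 * r * \<bar>Im z\<bar>"
        by (simp add: norm_mult z complex_diff_cnj)
      have key: "norm (P z - P (cnj z)) * (2 * r * \<bar>Im z\<bar>) ^ M \<le> \<bar>C\<bar> * (2 * r ^ 3) ^ M"
      proof (cases "Im z = 0")
        case True
        then have "cnj z = z" by (simp add: complex_eq_iff)
        then show ?thesis using r1 by simp
      next
        case False
        have "norm (P z - P (cnj z)) \<le> C * (r\<^sup>2 / \<bar>Im z\<bar>) ^ M"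
        proof (cases "Im z > 0")
          case True
          then show ?thesis using bd[of z] z r1 by simp
        next
          case im: False
          then have "norm (P (cnj z) - P (cnj (cnj z))) \<le> C * ((norm (cnj z))\<^sup>2 / Im (cnj z)) ^ M"
            using False z r1 by (intro bd) auto
          then show ?thesis using z im by (simp add: norm_minus_commute)
        qed
        also have "\<dots> \<le> \<bar>C\<bar> * (r\<^sup>2 / \<bar>Im z\<bar>) ^ M" by (intro mult_right_mono) auto
        finally have "norm (P z - P (cnj z)) * (2 * r * \<bar>Im z\<bar>) ^ M \<le>
            \<bar>C\<bar> * (r\<^sup>2 / \<bar>Im z\<bar>) ^ M * (2 * r * \<bar>Im z\<bar>) ^ M"
          using r1 by (intro mult_right_mono) auto
        also have "\<dots> = \<bar>C\<bar> * (r\<^sup>2 / \<bar>Im z\<bar> * (2 * r * \<bar>Im z\<bar>)) ^ M"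
          by (simp only: power_mult_distrib mult.assoc)
        also have "r\<^sup>2 / \<bar>Im z\<bar> * (2 * r * \<bar>Im z\<bar>) = 2 * r ^ 3"
          using False by (simp add: power2_eq_square power3_eq_cube)
        finally show ?thesis .
      qed
      have "norm ((P z - P (cnj z)) * (z\<^sup>2 - of_real r ^ 2) ^ M / z ^ (l + 2 * M)) =
          norm (P z - P (cnj z)) * (2 * r * \<bar>Im z\<bar>) ^ M / r ^ (l + 2 * M)"
        by (simp add: norm_mult norm_divide norm_power z w)
      also have "\<dots> \<le> \<bar>C\<bar> * (2 * r ^ 3) ^ M / r ^ (l + 2 * M)"
        using key r1 by (intro divide_right_mono) auto
      \<comment> \<open>From \<open>l > M\<close> follows \<open>l + 2 * M \<ge> 3 * M + 1\<close>,
        one power of \<open>r\<close> more than the numerator has.\<close>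
      also have "\<dots> \<le> \<bar>C\<bar> * (2 * r ^ 3) ^ M / r ^ (3 * M + 1)"
        using r1 that \<open>l > M\<close> by (intro divide_left_mono power_increasing mult_nonneg_nonneg) auto
      also have "\<dots> = \<bar>C\<bar> * 2 ^ M / r"
      proof -
        have "r ^ (3 * M + 1) = (r ^ 3) ^ M * r" by (simp only: power_add power_mult power_one_right)
        then show ?thesis using r1 by (simp only: power_mult_distrib) simp
      qed
      finally show ?thesis .
    qed
    have bnd: "norm (\<Sum>k\<le>M. a k * of_real (r\<^sup>2) ^ k) \<le> \<bar>C\<bar> * 2 ^ M / r * (2 * pi)" if r: "r > max R 1" for r
    proof -
      have "norm (\<Sum>k\<le>M. a k * of_real (r\<^sup>2) ^ k) \<le> \<bar>C\<bar> * 2 ^ M / r * measure lborel {0..2*pi}"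
      proof (rule has_integral_bound[where a = 0 and b = "2*pi", unfolded cbox_interval])
        show "((\<lambda>t. (P (of_real r * cis t) - P (cnj (of_real r * cis t))) *
            ((of_real r * cis t)\<^sup>2 - of_real r ^ 2) ^ M / (of_real r * cis t) ^ (l + 2 * M)) has_integral
            (\<Sum>k\<le>M. a k * of_real (r\<^sup>2) ^ k)) {0..2*pi}"
          unfolding a_def by (rule weighted_circle_integral[OF P]) (use r \<open>l > M\<close> in auto)
              show "norm ((P (of_real r * cis t) - P (cnj (of_real r * cis t))) *
            ((of_real r * cis t)\<^sup>2 - of_real r ^ 2) ^ M / (of_real r * cis t) ^ (l + 2 * M)) \<le> \<bar>C\<bar> * 2 ^ M / r" for t
          by (rule pt[OF _ r]) (use r in \<open>simp add: norm_mult\<close>)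
      qed (use r in simp)
      then show ?thesis by simp
    qed
    \<comment> \<open>The variable is \<open>t = r\<^sup>2\<close>, so the bound in
      \<open>1 / r\<close> becomes one in \<open>1 / sqrt t\<close>.\<close>
    have "((\<lambda>t::real. (\<Sum>k\<le>M. a k * of_real t ^ k) / of_real t ^ 0) \<longlongrightarrow> 0) at_top"
    proof (rule Lim_null_comparison)
      show "((\<lambda>t. \<bar>C\<bar> * 2 ^ M / sqrt t * (2 * pi)) \<longlongrightarrow> 0) at_top"
        by real_asymp
      show "\<forall>\<^sub>F t in at_top. norm ((\<Sum>k\<le>M. a k * of_real t ^ k) / of_real t ^ 0) \<le> \<bar>C\<bar> * 2 ^ M / sqrt t * (2 * pi)"
        using eventually_gt_at_top[of "(max R 1)\<^sup>2"]
      proof eventually_elim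
        case (elim t)
        then have "sqrt t > max R 1" by (intro real_less_rsqrt)
        moreover have "(sqrt t)\<^sup>2 = t" using elim by (simp add: order_trans[OF zero_le_power2 less_imp_le])
        ultimately show ?case using bnd[of "sqrt t"] by simp
      qed
    qed
    then have "a 0 = 0" by (rule coeffs_zero_of_growth) auto
    then show ?thesis by (simp add: a_def)
  qed
  have "(\<lambda>k. ?b k * (z - 0) ^ k) sums P z"
    by (rule holomorphic_power_series[of P 0 "norm z + 1"]) (use P in \<open>auto intro: holomorphic_on_subset\<close>)
  moreover have "(\<lambda>k. ?b k * (z - 0) ^ k) sums (\<Sum>k\<in>{..M}. ?b k * (z - 0) ^ k)"
    by (rule sums_finite) (use zero in \<open>auto simp: not_le\<close>)
  ultimately show ?thesis using sums_unique2 by fastforce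
qed

section \<open>An approximate identity\<close>

text \<open>The classical bump \<open>exp (- 1 / (1 - t\<^sup>2))\<close> with a polynomial and a
  power of \<open>1 / (1 - t\<^sup>2)\<close> as extra factors, which make the family closed under
  differentiation.\<close>

definition bump_term :: "real poly \<Rightarrow> nat \<Rightarrow> real \<Rightarrow> real" where
  "bump_term p k t =
     (if \<bar>t\<bar> < 1 then poly p t * (1 / (1 - t\<^sup>2)) ^ k * exp (- (1 / (1 - t\<^sup>2))) else 0)"

text \<open>Raise \<open>x \<le> exp x\<close> at \<open>x = w / n\<close> to the
  \<open>n\<close>-th power. This makes the exponential beat every power of
  \<open>1 / (1 - t\<^sup>2)\<close> near the endpoints of the support.\<close>

lemma power_mult_exp_minus_bounded:
  fixes w :: real
  assumes "w \<ge> 0" "n > 0"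
  shows "w ^ n * exp (- w) \<le> real n ^ n"
proof -
  have "w / real n \<le> exp (w / real n)" using exp_ge_add_one_self[of "w / real n"] by linarith
  then have "(w / real n) ^ n \<le> exp (w / real n) ^ n" using assms by (intro power_mono) auto
  also have "\<dots> = exp w" using assms(2) by (rule exp_divide_power_eq)
  finally have "w ^ n \<le> real n ^ n * exp w" using assms(2) by (simp add: power_divide field_simps)
  then show ?thesis by (simp add: exp_minus field_simps)
qed

text \<open>With \<open>w = 1 / (1 - t\<^sup>2)\<close> one has
  \<open>w' = 2 * t * w\<^sup>2\<close>, and inserting factors
  \<open>w * (1 - t\<^sup>2) = 1\<close> brings all terms to the common power
  \<open>w ^ (k + 2)\<close>. Where \<open>1 \<le> \<bar>t\<bar>\<close>, a quadratic bound gives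
  derivative 0.\<close>

lemma bump_term_has_real_derivative:
  "(bump_term p k has_real_derivative
     bump_term (pderiv p * [:1, 0, -1:]\<^sup>2 + smult (2 * real k) ([:0, 1:] * p * [:1, 0, -1:]) - smult 2 ([:0, 1:] * p))
       (k + 2) t) (at t)"
  (is "(_ has_real_derivative bump_term ?q _ _) _")
proof (cases "\<bar>t\<bar> < 1")
  case True
  let ?w = "\<lambda>t::real. 1 / (1 - t\<^sup>2)"
  have nz: "1 - t\<^sup>2 \<noteq> 0" using True by (simp add: abs_square_eq_1)
  have qt: "poly ?q t = poly (pderiv p) t * (1 - t\<^sup>2)\<^sup>2 + 2 * real k * (t * poly p t * (1 - t\<^sup>2)) - 2 * (t * poly p t)"
    by (simp add: power2_eq_square algebra_simps)
  have dw: "(?w has_real_derivative 2 * t * (?w t)\<^sup>2) (at t)"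
    using nz by (auto intro!: derivative_eq_intros simp: power2_eq_square)
  have dwk: "((\<lambda>t. ?w t ^ k) has_real_derivative real k * ?w t ^ (k - 1) * (2 * t * (?w t)\<^sup>2)) (at t)"
    using DERIV_power[OF dw, of k] by (simp add: mult_ac)
  have "((\<lambda>t. poly p t * ?w t ^ k * exp (- ?w t)) has_real_derivative
      (poly (pderiv p) t * ?w t ^ k + real k * ?w t ^ (k - 1) * (2 * t * (?w t)\<^sup>2) * poly p t) * exp (- ?w t) +
      exp (- ?w t) * - (2 * t * (?w t)\<^sup>2) * (poly p t * ?w t ^ k)) (at t)"
    by (intro DERIV_mult poly_DERIV dwk DERIV_chain2[OF DERIV_exp] DERIV_minus dw)
  moreover have "(poly (pderiv p) t * ?w t ^ k + real k * ?w t ^ (k - 1) * (2 * t * (?w t)\<^sup>2) * poly p t) * exp (- ?w t) +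
      exp (- ?w t) * - (2 * t * (?w t)\<^sup>2) * (poly p t * ?w t ^ k) = bump_term ?q (k + 2) t"
  proof -
    define W where "W = ?w t"
    have W: "W * (1 - t\<^sup>2) = 1" using nz by (simp add: W_def)
    have E: "poly (pderiv p) t * W ^ k + real k * W ^ (k - 1) * (2 * t * W\<^sup>2) * poly p t - (2 * t * W\<^sup>2) * (poly p t * W ^ k) =
      poly ?q t * W ^ (k + 2)"
    proof -
      define v where "v = 1 - t\<^sup>2"
      have Wv: "W * v = 1" using W by (simp add: v_def)
      have e1: "real k * W ^ (k - 1) * (2 * t * W\<^sup>2) = 2 * t * (real k * W ^ k * W)"
        by (cases k) (auto simp: power2_eq_square)
      have e2: "W ^ (k + 2) * v\<^sup>2 = W ^ k"
      proof -
        have "W ^ (k + 2) * v\<^sup>2 = W ^ k * (W * v)\<^sup>2" by (simp only: power_add power_mult_distrib mult.assoc)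
        then show ?thesis by (simp add: Wv)
      qed
      have e3: "W ^ (k + 2) * v = W ^ k * W"
      proof -
        have "W ^ (k + 2) * v = W ^ k * W * (W * v)" by (simp add: power_add power2_eq_square)
        then show ?thesis by (simp add: Wv)
      qed
      have e4: "poly ?q t * W ^ (k + 2) = poly (pderiv p) t * (W ^ (k + 2) * v\<^sup>2) +
          2 * real k * (t * poly p t * (W ^ (k + 2) * v)) - 2 * (t * poly p t) * W ^ (k + 2)"
        unfolding qt v_def[symmetric] by algebra
      show ?thesis unfolding e1 e4 e2 e3 by (simp add: power_add power2_eq_square)
    qed
    have "(a + b * c) * e + e * - d * g = (a + b * c - d * g) * e" for a b c d e g :: real
      by (simp add: algebra_simps)
    then show ?thesis using True unfolding bump_term_def W_def[symmetric] by (simp only: E if_True)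
  qed
  ultimately have "((\<lambda>t. poly p t * ?w t ^ k * exp (- ?w t)) has_real_derivative bump_term ?q (k + 2) t) (at t)"
    by simp
  then show ?thesis
    by (rule has_field_derivative_transform_within_open[of _ _ _ "{-1<..<1}"])
       (use True in \<open>auto simp: bump_term_def abs_less_iff\<close>)
next
  case False
  have "compact (poly p ` {-1..1})"
    by (intro compact_continuous_image compact_Icc continuous_intros)
  then obtain K where "\<And>v. v \<in> poly p ` {-1..1} \<Longrightarrow> norm v \<le> K"
    by (metis compact_imp_bounded bounded_iff)
  then have K: "\<bar>poly p s\<bar> \<le> K" if "\<bar>s\<bar> \<le> 1" for s using that by (simp add: abs_le_iff)
  have K0: "K \<ge> 0" using K[of 0] by linarith
  define L where "L = K * real (k + 2) ^ (k + 2)"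
  have L0: "L \<ge> 0" using K0 by (simp add: L_def)
  \<comment> \<open>Two further powers of \<open>1 / (1 - s\<^sup>2)\<close> are absorbed by the
    exponential, which leaves a factor \<open>(1 - s\<^sup>2)\<^sup>2\<close>. Since
    \<open>1 \<le> \<bar>t\<bar>\<close>,
    \<open>1 - s\<^sup>2 = (1 - \<bar>s\<bar>) * (1 + \<bar>s\<bar>)\<close> is at most
    \<open>2 * \<bar>s - t\<bar>\<close>; hence the 4.\<close>
  have bd: "\<bar>bump_term p k s\<bar> \<le> L * 4 * (s - t)\<^sup>2" for s
  proof (cases "\<bar>s\<bar> < 1")
    case s: True
    define v where "v = 1 - s\<^sup>2"
    have v: "0 < v" "v \<le> 2 * \<bar>s - t\<bar>"
    proof -
      show "0 < v" using s by (simp add: v_def abs_square_less_1)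
      have "v = (1 - \<bar>s\<bar>) * (1 + \<bar>s\<bar>)" by (simp add: v_def algebra_simps power2_eq_square)
      also have "\<dots> \<le> \<bar>s - t\<bar> * 2" using s False by (intro mult_mono) auto
      finally show "v \<le> 2 * \<bar>s - t\<bar>" by simp
    qed
    have "(1 / v) ^ k * exp (- (1 / v)) = (1 / v) ^ (k + 2) * exp (- (1 / v)) * v\<^sup>2"
      using v(1) by (simp add: power_add power2_eq_square)
    also have "\<dots> \<le> real (k + 2) ^ (k + 2) * v\<^sup>2"
      using v by (intro mult_right_mono power_mult_exp_minus_bounded) auto
    finally have "(1 / v) ^ k * exp (- (1 / v)) \<le> real (k + 2) ^ (k + 2) * v\<^sup>2" .
    from mult_mono[OF K[of s] this]
    have "\<bar>poly p s\<bar> * ((1 / v) ^ k * exp (- (1 / v))) \<le> K * (real (k + 2) ^ (k + 2) * v\<^sup>2)"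
      using s v(1) K0 by simp
    also have "\<dots> = L * v\<^sup>2" by (simp add: L_def)
    also have "\<dots> \<le> L * (2 * \<bar>s - t\<bar>)\<^sup>2" using v L0 by (intro mult_left_mono power_mono) auto
    finally show ?thesis using s v(1) by (simp add: bump_term_def abs_mult v_def[symmetric] power_mult_distrib mult_ac)
  next
    case False
    then show ?thesis using L0 by (simp add: bump_term_def)
  qed
  have "((\<lambda>s. (bump_term p k s - bump_term p k t) / (s - t)) \<longlongrightarrow> 0) (at t)"
  proof (rule Lim_null_comparison)
    show "\<forall>\<^sub>F s in at t. norm ((bump_term p k s - bump_term p k t) / (s - t)) \<le> L * 4 * \<bar>s - t\<bar>"
      unfolding eventually_at_filter
    proof (intro always_eventually allI impI)
      fix s assume "s \<noteq> t"
      then have "\<bar>s - t\<bar> \<noteq> 0" by simp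
      have "norm ((bump_term p k s - bump_term p k t) / (s - t)) = \<bar>bump_term p k s\<bar> / \<bar>s - t\<bar>"
        using False by (simp add: bump_term_def[of _ _ t] abs_divide)
      also have "\<dots> \<le> L * 4 * \<bar>s - t\<bar>\<^sup>2 / \<bar>s - t\<bar>"
        using bd[of s] by (intro divide_right_mono) simp_all
      also have "\<dots> = L * 4 * \<bar>s - t\<bar>"
        by (simp only: power2_eq_square times_divide_eq_right[symmetric] divide_self[OF \<open>\<bar>s - t\<bar> \<noteq> 0\<close>] mult_1_right)
      finally show "norm ((bump_term p k s - bump_term p k t) / (s - t)) \<le> L * 4 * \<bar>s - t\<bar>" .
    qed
    show "((\<lambda>s. L * 4 * \<bar>s - t\<bar>) \<longlongrightarrow> 0) (at t)"
      by (auto intro!: tendsto_eq_intros)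
  qed
  then show ?thesis using False by (simp add: has_field_derivative_iff bump_term_def[of _ _ t])
qed

lemma bump_derivs_exist:
  obtains D :: "nat \<Rightarrow> real \<Rightarrow> complex" where "bump_derivs D" "integral {-1..1} (D 0) \<noteq> 0"
proof -
  \<comment> \<open>Differentiation acting on the pair of polynomial and exponent; the start
    \<open>(1, 0)\<close> is the classical bump.\<close>
  define step :: "real poly \<times> nat \<Rightarrow> real poly \<times> nat" where
    "step = (\<lambda>(p, k). (pderiv p * [:1, 0, -1:]\<^sup>2 + smult (2 * real k) ([:0, 1:] * p * [:1, 0, -1:]) - smult 2 ([:0, 1:] * p), k + 2))"
  define s where "s = (\<lambda>m. (step ^^ m) (1, 0))"
  define F where "F = (\<lambda>m. bump_term (fst (s m)) (snd (s m)))"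
  define D :: "nat \<Rightarrow> real \<Rightarrow> complex" where "D = (\<lambda>m t. of_real (F m t))"
  have dF: "(F m has_real_derivative F (Suc m) t) (at t)" for m t
    unfolding F_def s_def funpow.simps o_def
    using bump_term_has_real_derivative[of "fst ((step ^^ m) (1, 0))" "snd ((step ^^ m) (1, 0))" t]
    by (simp add: step_def case_prod_unfold)
  have "bump_derivs D"
    unfolding bump_derivs_def
  proof (intro conjI allI impI)
    show "(D m has_vector_derivative D (Suc m) t) (at t)" for m t
      unfolding D_def using dF by (intro has_vector_derivative_of_real) (simp add: has_real_derivative_iff_has_vector_derivative)
    show "D m t = 0" if "1 \<le> \<bar>t\<bar>" for m t
      using that by (simp add: D_def F_def bump_term_def)
  qed
  moreover have "integral {-1..1} (D 0) \<noteq> 0"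
  proof -
    have cF: "continuous_on {-1..1} (F 0)"
      using dF by (meson DERIV_isCont continuous_at_imp_continuous_on)
    have F0: "F 0 t = (if \<bar>t\<bar> < 1 then exp (- (1 / (1 - t\<^sup>2))) else 0)" for t
      by (simp add: F_def s_def bump_term_def)
    have "integral {-1..1} (F 0) \<noteq> 0"
      using integral_eq_0_iff[OF cF] F0 by (auto intro!: bexI[of _ 0])
    moreover have "integral {-1..1} (D 0) = of_real (integral {-1..1} (F 0))"
      unfolding D_def using integral_linear[OF integrable_continuous_interval[OF cF] bounded_linear_of_real]
      by (simp add: o_def)
    ultimately show ?thesis by simp
  qed
  ultimately show thesis by (rule that)
qed

section \<open>Polynomial form of the mollified function, and the limit of shrinking bumps\<close>

lemma test_function_translate:
  assumes "bump_derivs D"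
  shows "test_function (\<lambda>t. D 0 (t - x))"
proof -
  have "(D k \<circ> (\<lambda>t. t - x) has_vector_derivative 1 *\<^sub>R D (Suc k) (t - x)) (at t)" for k t
    by (rule vector_diff_chain_at)
       (use assms in \<open>auto simp: bump_derivs_def intro!: derivative_eq_intros\<close>)
  then have "test_function ((\<lambda>k t. D k (t - x)) 0)"
    by (intro test_functionI[where r = "\<bar>x\<bar> + 1"]) (use assms in \<open>auto simp: bump_derivs_def o_def\<close>)
  then show ?thesis by simp
qed

text \<open>The number of terms is governed by the growth exponent \<open>M\<close> alone and is
  thus common to all bumps; only the coefficients \<open>b\<close> depend on \<open>D\<close>. This
  uniformity permits the later passage to the limit.\<close>

lemma mollified_polynomial:
  assumes A: "A holomorphic_on upper_half_plane" and B: "B holomorphic_on cnj ` upper_half_plane"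
    and u: "\<And>z. z \<in> upper_half_plane \<Longrightarrow> u z = A z + B (cnj z)"
    and van: "vanishing_distributional_boundary_values u"
    and growth: "\<And>z. Im z > 0 \<Longrightarrow> norm z > R \<Longrightarrow> norm (u z) \<le> C * ((norm z)\<^sup>2 / Im z) ^ M"
    and C: "C \<ge> 0" and D: "bump_derivs D"
  obtains b where "\<And>z. Im z > 0 \<Longrightarrow> mollify (D 0) u z = (\<Sum>k\<le>M. b k * (z ^ k - cnj z ^ k))"
proof -
  have H: "upper_half_plane = {z. Im z > 0}" by (simp add: upper_half_plane_def)
  have L: "cnj ` upper_half_plane = {z. Im z < 0}" by (rule cnj_upper_half_plane)
  have cA: "continuous_on {z. Im z > 0} A" using A H holomorphic_on_imp_continuous_on by metis
  have cB: "continuous_on {z. Im z < 0} B" using B L holomorphic_on_imp_continuous_on by metis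
  have cu: "continuous_on upper_half_plane u"
  proof -
    have "continuous_on upper_half_plane (\<lambda>z. A z + B (cnj z))"
      by (intro continuous_intros continuous_on_compose2[OF cA] continuous_on_compose2[OF cB]) (auto simp: H)
    then show ?thesis using u by (simp cong: continuous_on_cong)
  qed
  define Am where "Am = (\<lambda>k. mollify (D k) A)"
  define Bm where "Bm = (\<lambda>k. mollify (D k) B)"
  have dA: "(Am k has_field_derivative - Am (Suc k) z) (at z)" if "Im z > 0" for k z
    unfolding Am_def
    by (rule mollify_has_field_derivative[OF D A open_upper_half_plane convex_upper_half_plane])
       (use that in \<open>auto simp: H\<close>)
  have dB: "(Bm k has_field_derivative - Bm (Suc k) z) (at z)" if "Im z < 0" for k z
    unfolding Bm_def
    by (rule mollify_has_field_derivative[OF D B])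
       (use that in \<open>auto simp: L open_halfspace_Im_lt convex_halfspace_Im_lt\<close>)
  have sum: "mollify (D k) u z = Am k z + Bm k (cnj z)" if "Im z > 0" for k z
  proof -
    have "continuous_on {-1..1} (\<lambda>t. A (z + of_real t) * D k t)"
      by (intro continuous_intros continuous_on_compose2[OF cA] bump_derivs_continuous_on[OF D])
         (use that in auto)
    moreover have "continuous_on {-1..1} (\<lambda>t. B (cnj z + of_real t) * D k t)"
      by (intro continuous_intros continuous_on_compose2[OF cB] bump_derivs_continuous_on[OF D])
         (use that in auto)
    ultimately have "Am k z + Bm k (cnj z) =
        integral {-1..1} (\<lambda>t. A (z + of_real t) * D k t + B (cnj z + of_real t) * D k t)"
      unfolding Am_def Bm_def mollify_def
      by (intro integral_add[symmetric] integrable_continuous_interval)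
    also have "\<dots> = mollify (D k) u z"
      unfolding mollify_def using that by (simp add: u H distrib_right)
    finally show ?thesis by simp
  qed
  have cnjC: "cnj (Complex x y) = Complex x (- y)" for x y by (simp add: complex_eq_iff)
  \<comment> \<open>Shifting the sequence \<open>D\<close> turns the boundedness lemma for a bump
    into one for each of its derivatives.\<close>
  have bnd: "\<exists>K. \<forall>x y. \<bar>x\<bar> \<le> a \<and> 0 < y \<and> y \<le> 1 \<longrightarrow> norm (Am k (Complex x y) + Bm k (Complex x (- y))) \<le> K" for k a
  proof -
    obtain K where K: "\<And>x y. \<bar>x\<bar> \<le> a \<Longrightarrow> 0 < y \<Longrightarrow> y \<le> 1 \<Longrightarrow> norm (mollify (D k) u (Complex x y)) \<le> K"
      using mollify_bounded_near_boundary[OF bump_derivs_shift[OF D, of k] cu van, of a] by auto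
    have "norm (Am k (Complex x y) + Bm k (Complex x (- y))) \<le> K" if "\<bar>x\<bar> \<le> a" "0 < y" "y \<le> 1" for x y
      using K[OF that] sum[of "Complex x y" k] that by (simp add: cnjC)
    then show ?thesis by blast
  qed
  obtain P where P: "P holomorphic_on UNIV" and PA: "\<And>z. Im z > 0 \<Longrightarrow> P z = Am 0 z"
    and PB: "\<And>z. Im z < 0 \<Longrightarrow> P z = - Bm 0 z"
  proof (rule glue_across_real_axis[of "Am 0" "\<lambda>z. - Am 1 z" "Am 2" "Bm 0" "\<lambda>z. - Bm 1 z" "Bm 2"])
    show "((\<lambda>z. - Am 1 z) has_field_derivative Am 2 z) (at z)" if "Im z > 0" for z
      using DERIV_minus[OF dA[OF that, of 1]] by (simp add: numeral_2_eq_2)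
    show "((\<lambda>z. - Bm 1 z) has_field_derivative Bm 2 z) (at z)" if "Im z < 0" for z
      using DERIV_minus[OF dB[OF that, of 1]] by (simp add: numeral_2_eq_2)
    have "norm (- Am 1 z + - Bm 1 w) = norm (Am 1 z + Bm 1 w)" for z w
      by (metis minus_add_distrib norm_minus_cancel)
    then show "\<exists>K. \<forall>x y. \<bar>x\<bar> \<le> a \<and> 0 < y \<and> y \<le> 1 \<longrightarrow> norm (- Am 1 (Complex x y) + - Bm 1 (Complex x (- y))) \<le> K" for a
      using bnd[of a 1] by simp
    show "((\<lambda>y. Am 0 (Complex x y) + Bm 0 (Complex x (- y))) \<longlongrightarrow> 0) (at_right 0)" for x
    proof (rule Lim_transform_eventually)
      show "((\<lambda>y. LINT t|lborel. u (Complex t y) * D 0 (t - x)) \<longlongrightarrow> 0) (at_right 0)"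
        using van test_function_translate[OF D, of x]
        unfolding vanishing_distributional_boundary_values_def by blast
      show "\<forall>\<^sub>F y in at_right 0. (LINT t|lborel. u (Complex t y) * D 0 (t - x)) = Am 0 (Complex x y) + Bm 0 (Complex x (- y))"
        using eventually_at_right_less
      proof eventually_elim
        case (elim y)
        then show ?case using sum[of "Complex x y" 0] mollify_eq_lint[OF D cu elim, of 0 x] by (simp add: cnjC)
      qed
    qed
  qed (use dA[of _ 0] dB[of _ 0] bnd[of _ 2] in auto)
  have PW: "P z - P (cnj z) = mollify (D 0) u z" if "Im z > 0" for z
    using PA[OF that] PB[of "cnj z"] sum[OF that, of 0] that by simp
  obtain K where K: "\<And>t. norm (D 0 t) \<le> K" using bump_derivs_bounded[OF D] by blast
  have K0: "K \<ge> 0" using order_trans[OF norm_ge_zero K[of 0]] .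
  \<comment> \<open>A horizontal shift by at most 1 keeps \<open>Im z\<close>, at most doubles
    \<open>norm z\<close> because \<open>norm z > 1\<close> (hence \<open>4 ^ M\<close>), and stays
    outside radius \<open>R\<close> because the threshold is raised by 1. The final 2 is the length
    of \<open>{-1..1}\<close>.\<close>
  have grow: "norm (P z - P (cnj z)) \<le> C * 4 ^ M * K * 2 * ((norm z)\<^sup>2 / Im z) ^ M"
    if z: "norm z > max R 0 + 1" "Im z > 0" for z
  proof -
    let ?B = "C * 4 ^ M * ((norm z)\<^sup>2 / Im z) ^ M * K"
    have bd: "norm (u (z + of_real t) * D 0 t) \<le> ?B" if t: "t \<in> {-1..1}" for t
    proof -
      have n: "norm (z + of_real t) > R" "norm (z + of_real t) \<le> 2 * norm z"
        using norm_triangle_ineq[of z "of_real t"] norm_diff_ineq[of z "of_real t"] t z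
        by (auto simp: abs_le_iff norm_of_real)
      have "norm (u (z + of_real t)) \<le> C * ((norm (z + of_real t))\<^sup>2 / Im z) ^ M"
        using growth[of "z + of_real t"] n z by simp
      also have "\<dots> \<le> C * ((2 * norm z)\<^sup>2 / Im z) ^ M"
        using n z C by (intro mult_left_mono power_mono divide_right_mono) auto
      also have "\<dots> = C * 4 ^ M * ((norm z)\<^sup>2 / Im z) ^ M"
        by (simp add: power_mult_distrib power_divide)
      finally show ?thesis
        unfolding norm_mult using K[of t] C z by (intro mult_mono) auto
    qed
    have cont: "continuous_on {-1..1} (\<lambda>t. u (z + of_real t) * D 0 t)"
      by (intro continuous_intros continuous_on_compose2[OF cu] bump_derivs_continuous_on[OF D])
         (use z in \<open>auto simp: H\<close>)
    have "norm (mollify (D 0) u z) \<le> ?B * (1 - - 1)"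
      unfolding mollify_def by (rule integral_bound[OF _ cont]) (use bd in auto)
    then show ?thesis using PW[OF z(2)] by (simp add: mult_ac)
  qed
  have Ppoly: "P w = (\<Sum>k\<le>M. (deriv ^^ k) P 0 / fact k * w ^ k)" for w
    by (rule entire_temperate_imp_polynomial[OF P grow])
  show thesis
  proof (rule that)
    fix z :: complex assume z: "Im z > 0"
    show "mollify (D 0) u z = (\<Sum>k\<le>M. ((deriv ^^ k) P 0 / fact k) * (z ^ k - cnj z ^ k))"
      unfolding PW[OF z, symmetric] Ppoly[of z] Ppoly[of "cnj z"]
      by (simp add: sum_subtractf right_diff_distrib)
  qed
qed

text \<open>Of the \<open>k + 1\<close> factors \<open>1 / e\<close>, \<open>k\<close> come from the
  chain rule and one keeps the total integral fixed. Since \<open>e \<le> 1\<close>, the support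
  stays inside the unit interval.\<close>

lemma bump_derivs_scale:
  assumes D: "bump_derivs D" and e: "0 < e" "e \<le> 1"
  shows "bump_derivs (\<lambda>k t. of_real ((1 / e) ^ Suc k) * D k (t / e))"
  unfolding bump_derivs_def
proof (intro conjI allI impI)
  fix k t
  have "((\<lambda>t. t / e) has_vector_derivative 1 / e) (at t)"
    by (intro has_vector_derivative_divide has_vector_derivative_id)
  then have "(D k \<circ> (\<lambda>t. t / e) has_vector_derivative (1 / e) *\<^sub>R D (Suc k) (t / e)) (at t)"
    by (rule vector_diff_chain_at) (use D in \<open>simp add: bump_derivs_def\<close>)
  from has_vector_derivative_mult_right[OF this, of "of_real ((1 / e) ^ Suc k)"]
  show "((\<lambda>t. of_real ((1 / e) ^ Suc k) * D k (t / e)) has_vector_derivative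
      of_real ((1 / e) ^ Suc (Suc k)) * D (Suc k) (t / e)) (at t)"
    by (simp add: o_def scaleR_conv_of_real mult_ac)
next
  fix k and t :: real assume "1 \<le> \<bar>t\<bar>"
  then have "1 \<le> \<bar>t / e\<bar>" using e by (simp add: abs_divide le_divide_eq)
  then show "of_real ((1 / e) ^ Suc k) * D k (t / e) = 0" using D by (simp add: bump_derivs_def)
qed

text \<open>Substitution freezes the bump and moves the scaling into the argument of
  \<open>u\<close>, which stays within distance 1 of \<open>z\<close> on the support; dominated
  convergence then applies. The bump is not normalised, hence its integral in the limit.\<close>

lemma mollify_scale_tendsto:
  assumes D: "bump_derivs D" and u: "continuous_on upper_half_plane u" and z: "Im z > 0"
  shows "(\<lambda>n. mollify (\<lambda>t. of_real (real (Suc n)) * D 0 (t * real (Suc n))) u z) \<longlonglongrightarrow>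
     u z * integral {-1..1} (D 0)"
proof -
  define e where "e = (\<lambda>n. 1 / real (Suc n))"
  have e: "0 < e n" "e n \<le> 1" for n by (auto simp: e_def)
  have D0: "continuous_on UNIV (D 0)" "\<And>t. 1 \<le> \<bar>t\<bar> \<Longrightarrow> D 0 t = 0"
    using bump_derivs_continuous_on[OF D] D by (auto simp: bump_derivs_def)
  have cu: "continuous_on UNIV (\<lambda>t. u (z + of_real (c * t)))" for c
    by (rule continuous_on_compose2[OF u])
       (use z in \<open>auto simp: upper_half_plane_def intro!: continuous_intros\<close>)
  have eq: "mollify (\<lambda>t. of_real (real (Suc n)) * D 0 (t * real (Suc n))) u z =
     (LINT t|lborel. u (z + of_real (e n * t)) * D 0 t)" for n
  proof -
    let ?\<phi> = "\<lambda>t. of_real (real (Suc n)) * D 0 (t * real (Suc n))"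
    have "continuous_on UNIV ?\<phi>"
      by (intro continuous_intros continuous_on_compose2[OF D0(1)]) auto
    moreover have "?\<phi> t = 0" if "1 \<le> \<bar>t\<bar>" for t
    proof -
      have "1 * 1 \<le> \<bar>t\<bar> * real (Suc n)" using that by (intro mult_mono) auto
      then show ?thesis using D0(2) by (simp add: abs_mult)
    qed
    ultimately have "mollify ?\<phi> u z = (LINT t|lborel. u (z + of_real t) * ?\<phi> t)"
      using integrable_mult_bump(2)[of "\<lambda>t. u (z + of_real t)" ?\<phi> 0] cu[of 1] by (simp add: mollify_def)
    also have "\<dots> = e n *\<^sub>R (LINT t|lborel. u (z + of_real (0 + e n * t)) * ?\<phi> (0 + e n * t))"
      using lborel_integral_real_affine[of "e n" "\<lambda>t. u (z + of_real t) * ?\<phi> t" 0] e[of n] by simp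
    also have "\<dots> = (LINT t|lborel. e n *\<^sub>R (u (z + of_real (0 + e n * t)) * ?\<phi> (0 + e n * t)))"
      by (rule integral_scaleR_right[symmetric])
    also have "\<dots> = (LINT t|lborel. u (z + of_real (e n * t)) * D 0 t)"
      by (intro Bochner_Integration.integral_cong refl)
         (simp add: e_def scaleR_conv_of_real del: of_nat_Suc)
    finally show ?thesis .
  qed
  have "compact ((\<lambda>t. u (z + of_real t)) ` {-1..1})"
    using cu[of 1] by (intro compact_continuous_image compact_Icc) (auto intro: continuous_on_subset)
  then obtain K where "\<And>v. v \<in> (\<lambda>t. u (z + of_real t)) ` {-1..1} \<Longrightarrow> norm v \<le> K"
    by (metis compact_imp_bounded bounded_iff)
  then have K: "\<And>t. \<bar>t\<bar> \<le> 1 \<Longrightarrow> norm (u (z + of_real t)) \<le> K" by (auto simp: abs_le_iff)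
  have K0: "K \<ge> 0" by (rule order_trans[OF norm_ge_zero K[of 0]]) simp
  have intD: "integrable lborel (D 0)"
    using integrable_mult_bump(1)[of "\<lambda>_. 1" "D 0" 0] D0 by simp
  have lim: "(\<lambda>n. LINT t|lborel. u (z + of_real (e n * t)) * D 0 t) \<longlonglongrightarrow> (LINT t|lborel. u z * D 0 t)"
  proof (rule integral_dominated_convergence[where w = "\<lambda>t. K * norm (D 0 t)"])
    show "integrable lborel (\<lambda>t. K * norm (D 0 t))"
      by (intro integrable_mult_right integrable_norm intD)
    show "(\<lambda>t. u z * D 0 t) \<in> borel_measurable lborel"
      using intD by (intro borel_measurable_integrable integrable_mult_right)
    show "(\<lambda>t. u (z + of_real (e n * t)) * D 0 t) \<in> borel_measurable lborel" for n
      using integrable_mult_bump(1)[OF cu[of "e n"] D0, of 0] by auto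
    show "AE t in lborel. norm (u (z + of_real (e n * t)) * D 0 t) \<le> K * norm (D 0 t)" for n
    proof (intro AE_I2)
      fix t :: real
      show "norm (u (z + of_real (e n * t)) * D 0 t) \<le> K * norm (D 0 t)"
      proof (cases "\<bar>t\<bar> \<le> 1")
        case True
        then have "\<bar>e n * t\<bar> \<le> 1" using e[of n] by (simp add: abs_mult mult_le_one)
        then show ?thesis using K by (simp add: norm_mult mult_right_mono del: of_real_mult)
      next
        case False
        then show ?thesis using D0(2)[of t] by simp
      qed
    qed
    show "AE t in lborel. (\<lambda>n. u (z + of_real (e n * t)) * D 0 t) \<longlonglongrightarrow> u z * D 0 t"
    proof (intro AE_I2)
      fix t :: real
      have "e \<longlonglongrightarrow> 0"
        unfolding e_def using LIMSEQ_inverse_real_of_nat by (simp add: inverse_eq_divide)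
      then have "(\<lambda>n. z + of_real (e n * t)) \<longlonglongrightarrow> z + of_real (0 * t)"
        by (intro tendsto_intros)
      moreover have "isCont u z"
        using u z open_upper_half_plane by (auto simp: continuous_on_eq_continuous_at upper_half_plane_def)
      ultimately have "(\<lambda>n. u (z + of_real (e n * t))) \<longlonglongrightarrow> u z"
        by (intro isCont_tendsto_compose[of z u]) auto
      then show "(\<lambda>n. u (z + of_real (e n * t)) * D 0 t) \<longlonglongrightarrow> u z * D 0 t"
        by (intro tendsto_intros)
    qed
  qed
  have val: "(LINT t|lborel. u z * D 0 t) = u z * integral {-1..1} (D 0)"
    using integrable_mult_bump(2)[of "\<lambda>_. 1" "D 0" 0] D0 by simp
  show ?thesis using lim unfolding eq val .
qed

text \<open>Induction on the degree: the combination \<open>p (2 * t) - 2 ^ Suc N * p t\<close>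
  removes the top coefficient and multiplies the \<open>k\<close>-th one by
  \<open>2 ^ k - 2 ^ Suc N\<close>, which is nonzero for \<open>k \<le> N\<close>.\<close>

lemma coeffs_convergent:
  fixes a :: "nat \<Rightarrow> nat \<Rightarrow> complex"
  assumes "\<And>t::real. t > 0 \<Longrightarrow> convergent (\<lambda>j. \<Sum>k\<le>N. a j k * of_real t ^ k)" and "k \<le> N"
  shows "convergent (\<lambda>j. a j k)"
  using assms
proof (induction N arbitrary: a k)
  case 0
  then show ?case using "0.prems"(1)[of 1] by simp
next
  case (Suc N)
  have low: "convergent (\<lambda>j. a j k)" if "k \<le> N" for k
  proof -
    define c where "c = (\<lambda>k. (2::complex) ^ k - 2 ^ Suc N)"
    have cv: "convergent (\<lambda>j. a j k * c k)"
    proof (rule Suc.IH[OF _ that])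
      fix t :: real assume t: "t > 0"
      have "convergent (\<lambda>j. (\<Sum>k\<le>Suc N. a j k * of_real (2 * t) ^ k) - 2 ^ Suc N * (\<Sum>k\<le>Suc N. a j k * of_real t ^ k))"
        using Suc.prems(1)[of "2 * t"] Suc.prems(1)[of t] t
        by (intro convergent_diff convergent_mult convergent_const) auto
      also have "(\<lambda>j. (\<Sum>k\<le>Suc N. a j k * of_real (2 * t) ^ k) - 2 ^ Suc N * (\<Sum>k\<le>Suc N. a j k * of_real t ^ k)) =
         (\<lambda>j. \<Sum>k\<le>Suc N. a j k * c k * of_real t ^ k)"
        by (simp only: sum_distrib_left sum_subtractf[symmetric])
           (intro ext sum.cong refl, simp add: c_def power_mult_distrib algebra_simps)
      finally show "convergent (\<lambda>j. \<Sum>k\<le>N. a j k * c k * of_real t ^ k)" by (simp add: c_def)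
    qed
    have "c k \<noteq> 0"
    proof -
      have "(2::real) ^ k \<noteq> 2 ^ Suc N"
        using that power_strict_increasing[of k "Suc N" "2::real"] by auto
      then have "of_real (2 ^ k) \<noteq> (of_real (2 ^ Suc N) :: complex)" by (simp only: of_real_eq_iff not_False_eq_True)
      then show ?thesis by (simp add: c_def)
    qed
    have X: "convergent (\<lambda>j. a j k * c k * (1 / c k))"
      by (rule convergent_mult[OF cv convergent_const])
    have E: "(\<lambda>j. a j k * c k * (1 / c k)) = (\<lambda>j. a j k)"
      using \<open>c k \<noteq> 0\<close> by simp
    show ?thesis using X unfolding E .
  qed
  have "convergent (\<lambda>j. (\<Sum>k\<le>Suc N. a j k * of_real 1 ^ k) - (\<Sum>k\<le>N. a j k))"
    by (intro convergent_diff Suc.prems(1) convergent_sum low) auto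
  then have "convergent (\<lambda>j. a j (Suc N))" by simp
  then show ?case using low[of k] \<open>k \<le> Suc N\<close> by (cases "k = Suc N") auto
qed

section \<open>The uniqueness theorem\<close>

text \<open>For \<open>norm z \<ge> 1\<close> the base is at least 1, as
  \<open>Im z \<le> norm z \<le> (norm z)\<^sup>2\<close>, so the real exponent may be rounded up. A
  natural exponent is what the binomial weight on circles requires.\<close>

lemma temperate_growth_nat_exponent:
  assumes "temperate_growth_at_infinity u"
  obtains C R :: real and M :: nat where "C \<ge> 0"
    "\<And>z. Im z > 0 \<Longrightarrow> norm z > R \<Longrightarrow> norm (u z) \<le> C * ((norm z)\<^sup>2 / Im z) ^ M"
proof -
  obtain C R N where C: "C > 0" and
    b: "\<And>z. Im z > 0 \<Longrightarrow> norm z > R \<Longrightarrow> norm (u z) \<le> C * ((norm z)\<^sup>2 / Im z) powr N"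
    using assms unfolding temperate_growth_at_infinity_def upper_half_plane_def by auto
  define M where "M = nat \<lceil>N\<rceil>"
  have M: "N \<le> real M" unfolding M_def by linarith
  show thesis
  proof (rule that[of C "max R 1" M])
    fix z assume z: "Im z > 0" "norm z > max R 1"
    let ?x = "(norm z)\<^sup>2 / Im z"
    have "Im z \<le> norm z" using abs_Im_le_cmod[of z] by linarith
    also have "norm z * 1 \<le> norm z * norm z" using z by (intro mult_left_mono) auto
    finally have x: "1 \<le> ?x" using z by (simp add: power2_eq_square)
    have "norm (u z) \<le> C * ?x powr N" using b z by simp
    also have "?x powr N \<le> ?x powr real M" using x M by (intro powr_mono) auto
    also have "?x powr real M = ?x ^ M" using x by (intro powr_realpow) linarith
    finally show "norm (u z) \<le> C * ?x ^ M" using C by simp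
  qed (use C in simp)
qed

lemma cis_power_diff:
  "(of_real t * cis \<alpha>) ^ k - cnj (of_real t * cis \<alpha>) ^ k = 2 * \<i> * of_real (sin (real k * \<alpha>)) * of_real t ^ k"
proof -
  have "cnj (of_real t * cis \<alpha>) = of_real t * cis (- \<alpha>)"
    by (simp only: complex_cnj_mult complex_cnj_complex_of_real cis_cnj)
  then have "(of_real t * cis \<alpha>) ^ k - cnj (of_real t * cis \<alpha>) ^ k =
      of_real t ^ k * (cis (real k * \<alpha>) - cis (- (real k * \<alpha>)))"
    by (simp only: power_mult_distrib Complex.DeMoivre right_diff_distrib mult_minus_right)
  also have "cis (real k * \<alpha>) - cis (- (real k * \<alpha>)) = 2 * \<i> * of_real (sin (real k * \<alpha>))"
    by (simp add: complex_eq_iff)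
  finally show ?thesis by (simp add: mult_ac)
qed

lemma sin_nat_mult_nonzero_of_irrational:
  assumes "\<theta> / pi \<notin> \<rat>" "k > 0"
  shows "sin (real k * \<theta>) \<noteq> 0"
proof
  assume "sin (real k * \<theta>) = 0"
  then obtain i :: int where "real k * \<theta> = of_int i * pi" by (auto simp: sin_zero_iff_int2)
  then have "\<theta> / pi = of_int i / of_nat k" using assms(2) by (simp add: field_simps)
  then show False using assms(1) by (metis Rats_divide Rats_of_int Rats_of_nat)
qed

lemma sin_nat_mult_rational_eq_0_imp_dvd:
  assumes "sin (real k * (real m / real n * pi)) = 0" "coprime m n" "n > 0"
  shows "n dvd k"
proof -
  obtain i :: int where "real k * (real m / real n * pi) = of_int i * pi"
    using assms(1) by (auto simp: sin_zero_iff_int2)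
  then have "real k * real m = of_int i * real n" using assms(3) by (simp add: field_simps)
  then have "int k * int m = i * int n"
    by (metis of_int_eq_iff of_int_mult of_int_of_nat_eq)
  then have "int n dvd int (k * m)" by simp
  then have "n dvd k * m" by presburger
  then show ?thesis using assms(2) by (metis coprime_commute coprime_dvd_mult_left_iff)
qed

text \<open>The functions mollified by shrinking bumps lie in one finite-dimensional space and
  converge pointwise to a nonzero multiple of \<open>u\<close>. Convergence on a single ray already
  forces convergence of the coefficients.\<close>

lemma harmonic_temperate_polynomial:
  assumes "harmonic_on u upper_half_plane" "temperate_growth_at_infinity u"
    and van: "vanishing_distributional_boundary_values u"
  obtains M :: nat and c :: "nat \<Rightarrow> complex"
    where "\<And>z. Im z > 0 \<Longrightarrow> u z = (\<Sum>k\<le>M. c k * (z ^ k - cnj z ^ k))"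
proof -
  obtain A B where A: "A holomorphic_on upper_half_plane" and B: "B holomorphic_on cnj ` upper_half_plane"
    and u: "\<And>z. z \<in> upper_half_plane \<Longrightarrow> u z = A z + B (cnj z)"
    using harmonic_decomposition[OF assms(1)] by blast
  obtain C R M where C: "C \<ge> 0"
    and growth: "\<And>z. Im z > 0 \<Longrightarrow> norm z > R \<Longrightarrow> norm (u z) \<le> C * ((norm z)\<^sup>2 / Im z) ^ M"
    using temperate_growth_nat_exponent[OF assms(2)] by blast
  obtain D where D: "bump_derivs D" and D0: "integral {-1..1} (D 0) \<noteq> 0" by (rule bump_derivs_exist)
  define I where "I = integral {-1..1} (D 0)"
  have cu: "continuous_on upper_half_plane u"
  proof -
    have "continuous_on upper_half_plane (\<lambda>z. A z + B (cnj z))"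
      by (intro continuous_intros continuous_on_compose2[OF holomorphic_on_imp_continuous_on[OF A]]
           continuous_on_compose2[OF holomorphic_on_imp_continuous_on[OF B]]) auto
    then show ?thesis using u by (simp cong: continuous_on_cong)
  qed
  have "\<exists>b. \<forall>z. Im z > 0 \<longrightarrow>
      mollify (\<lambda>t. of_real (real (Suc j)) * D 0 (t * real (Suc j))) u z = (\<Sum>k\<le>M. b k * (z ^ k - cnj z ^ k))" for j
  proof -
    have "bump_derivs (\<lambda>k t. of_real ((1 / (1 / real (Suc j))) ^ Suc k) * D k (t / (1 / real (Suc j))))"
      by (rule bump_derivs_scale[OF D]) auto
    then have "bump_derivs (\<lambda>k t. of_real (real (Suc j) ^ Suc k) * D k (t * real (Suc j)))"
      by (simp del: of_nat_Suc power_Suc)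
    from mollified_polynomial[OF A B u van growth C this]
    obtain b where "\<And>z. Im z > 0 \<Longrightarrow>
        mollify (\<lambda>t. of_real (real (Suc j) ^ Suc 0) * D 0 (t * real (Suc j))) u z = (\<Sum>k\<le>M. b k * (z ^ k - cnj z ^ k))"
      by blast
    then show ?thesis by (intro exI[of _ b]) (simp only: power_Suc0_right, blast)
  qed
  then obtain b where b: "\<And>j z. Im z > 0 \<Longrightarrow>
      mollify (\<lambda>t. of_real (real (Suc j)) * D 0 (t * real (Suc j))) u z = (\<Sum>k\<le>M. b j k * (z ^ k - cnj z ^ k))"
    by metis
  have lim: "(\<lambda>j. \<Sum>k\<le>M. b j k * (z ^ k - cnj z ^ k)) \<longlonglongrightarrow> u z * I" if "Im z > 0" for z
    using mollify_scale_tendsto[OF D cu that] unfolding b[OF that] I_def .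
  \<comment> \<open>On this ray all \<open>sin (real k * \<alpha>)\<close> with
    \<open>1 \<le> k \<le> M\<close> are positive, so every such coefficient can be recovered from
    it.\<close>
  define \<alpha> where "\<alpha> = pi / real (Suc M)"
  have sin_al: "sin (real k * \<alpha>) > 0" if "0 < k" "k \<le> M" for k
  proof (rule sin_gt_zero)
    show "0 < real k * \<alpha>" using that by (simp add: \<alpha>_def)
    have "real k * pi < pi * real (Suc M)" using that by simp
    then show "real k * \<alpha> < pi" by (simp only: \<alpha>_def times_divide_eq_right pos_divide_less_eq of_nat_0_less_iff zero_less_Suc)
  qed
  \<comment> \<open>Index 0 is excluded: \<open>b j 0\<close> is multiplied by
    \<open>z ^ 0 - cnj z ^ 0 = 0\<close>, so the values of the functions say nothing about
    it.\<close>
  have conv: "\<exists>\<beta>. 0 < k \<and> k \<le> M \<longrightarrow> (\<lambda>j. b j k) \<longlonglongrightarrow> \<beta>" for k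
  proof (cases "0 < k \<and> k \<le> M")
    case True
    then have "sin \<alpha> > 0" using sin_al[of 1] by simp
    have "convergent (\<lambda>j. b j k * (2 * \<i> * of_real (sin (real k * \<alpha>))))"
    proof (rule coeffs_convergent[where N = M])
      fix t :: real assume "t > 0"
      then have "Im (of_real t * cis \<alpha>) > 0" using \<open>sin \<alpha> > 0\<close> by simp
      from lim[OF this] show "convergent (\<lambda>j. \<Sum>k\<le>M. b j k * (2 * \<i> * of_real (sin (real k * \<alpha>))) * of_real t ^ k)"
        unfolding cis_power_diff by (auto simp: convergent_def mult.assoc)
    qed (use True in simp)
    then obtain L where "(\<lambda>j. b j k * (2 * \<i> * of_real (sin (real k * \<alpha>)))) \<longlonglongrightarrow> L"
      by (auto simp: convergent_def)
    from tendsto_divide[OF this tendsto_const[of "2 * \<i> * of_real (sin (real k * \<alpha>))"]]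
    have "(\<lambda>j. b j k) \<longlonglongrightarrow> L / (2 * \<i> * of_real (sin (real k * \<alpha>)))"
      using sin_al[of k] True by simp
    then show ?thesis by blast
  qed auto
  then obtain \<beta> where \<beta>: "\<And>k. 0 < k \<Longrightarrow> k \<le> M \<Longrightarrow> (\<lambda>j. b j k) \<longlonglongrightarrow> \<beta> k" by metis
  show thesis
  proof (rule that)
    fix z :: complex assume z: "Im z > 0"
    have "(\<lambda>j. \<Sum>k\<le>M. b j k * (z ^ k - cnj z ^ k)) \<longlonglongrightarrow> (\<Sum>k\<le>M. \<beta> k * (z ^ k - cnj z ^ k))"
    proof (intro tendsto_sum)
      fix k assume "k \<in> {..M}"
      then show "(\<lambda>j. b j k * (z ^ k - cnj z ^ k)) \<longlonglongrightarrow> \<beta> k * (z ^ k - cnj z ^ k)"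
        using \<beta>[of k] by (cases "k = 0") (auto intro!: tendsto_mult)
    qed
    then have "u z * I = (\<Sum>k\<le>M. \<beta> k * (z ^ k - cnj z ^ k))"
      using lim[OF z] LIMSEQ_unique by blast
    then show "u z = (\<Sum>k\<le>M. (\<beta> k / I) * (z ^ k - cnj z ^ k))"
      using D0 by (simp add: I_def eq_divide_eq sum_divide_distrib[symmetric])
  qed
qed

theorem corollary8p6:
  fixes u :: "complex \<Rightarrow> complex" and m n :: nat and \<tau> :: real
  assumes "harmonic_on u upper_half_plane"
    and "temperate_growth_at_infinity u"
    and "0 < m" and "0 < n" and "coprime m n" and "m < n"
    and "\<tau> = real m / real n * pi"
    and "vanishing_distributional_boundary_values u"
    and "((\<lambda>t::real. u (of_real t * cis \<tau>) / of_real t) \<longlongrightarrow> 0) at_top"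
    and "\<exists>\<theta>::real. 0 < \<theta> \<and> \<theta> < pi \<and> \<theta> / pi \<notin> \<rat> \<and>
           ((\<lambda>t::real. u (of_real t * cis \<theta>) / of_real t ^ n) \<longlongrightarrow> 0) at_top"
  shows "\<forall>z\<in>upper_half_plane. u z = 0"
proof -
  obtain M :: nat and c where u: "\<And>z. Im z > 0 \<Longrightarrow> u z = (\<Sum>k\<le>M. c k * (z ^ k - cnj z ^ k))"
    using harmonic_temperate_polynomial[OF assms(1,2,8)] by blast
  obtain \<theta> where th: "0 < \<theta>" "\<theta> < pi" "\<theta> / pi \<notin> \<rat>"
    "((\<lambda>t::real. u (of_real t * cis \<theta>) / of_real t ^ n) \<longlongrightarrow> 0) at_top"
    using assms(10) by blast
  \<comment> \<open>On a ray \<open>u\<close> is a polynomial in \<open>t\<close>, and the sine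
    factor decides whether \<open>c k\<close> is visible there.\<close>
  have ray: "c k * (2 * \<i> * of_real (sin (real k * \<alpha>))) = 0"
    if "0 < \<alpha>" "\<alpha> < pi" and lim: "((\<lambda>t::real. u (of_real t * cis \<alpha>) / of_real t ^ l) \<longlongrightarrow> 0) at_top"
      and "l \<le> k" "k \<le> M" for \<alpha> k l
  proof (rule coeffs_zero_of_growth[OF _ that(4,5)])
    have "\<forall>\<^sub>F t in at_top. u (of_real t * cis \<alpha>) / of_real t ^ l =
        (\<Sum>k\<le>M. c k * (2 * \<i> * of_real (sin (real k * \<alpha>))) * of_real t ^ k) / of_real t ^ l"
      using eventually_gt_at_top[of "0::real"]
    proof eventually_elim
      case (elim t)
      then have "Im (of_real t * cis \<alpha>) > 0" using sin_gt_zero[OF that(1,2)] by simp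
      from u[OF this] show ?case unfolding cis_power_diff by (simp only: mult.assoc)
    qed
    with lim show "((\<lambda>t::real. (\<Sum>k\<le>M. c k * (2 * \<i> * of_real (sin (real k * \<alpha>))) * of_real t ^ k) / of_real t ^ l)
        \<longlongrightarrow> 0) at_top"
      by (rule Lim_transform_eventually)
  qed
  \<comment> \<open>If \<open>n dvd k\<close>, then \<open>sin (real k * \<tau>) = 0\<close> and the
    ray at angle \<open>\<tau>\<close> cannot see \<open>c k\<close>; but then
    \<open>k \<ge> n\<close>, within reach of the weaker decay on the irrational ray. Otherwise the
    decay relative to \<open>t\<close>, exponent 1, settles the coefficient.\<close>
  have c0: "c k = 0" if "0 < k" "k \<le> M" for k
  proof (cases "n dvd k")
    case True
    then have "n \<le> k" using that(1) by (rule dvd_imp_le)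
    then show ?thesis
      using ray[OF th(1,2,4) _ that(2)] sin_nat_mult_nonzero_of_irrational[OF th(3) that(1)] by simp
  next
    case False
    have "real m / real n < 1" using assms(4,6) by simp
    then have tau: "0 < \<tau>" "\<tau> < pi"
      using assms(3,4) mult_strict_right_mono[of "real m / real n" 1 pi] by (simp_all add: assms(7))
    have "sin (real k * \<tau>) \<noteq> 0"
      using sin_nat_mult_rational_eq_0_imp_dvd[of k m n] assms(4,5,7) False by blast
    then show ?thesis
      using ray[OF tau, of 1 k] assms(9) that by simp
  qed
  have "u z = 0" if "z \<in> upper_half_plane" for z
  proof -
    have "c k * (z ^ k - cnj z ^ k) = 0" if "k \<in> {..M}" for k
      using c0[of k] that by (cases "k = 0") auto
    then have "(\<Sum>k\<le>M. c k * (z ^ k - cnj z ^ k)) = 0" by (rule sum.neutral[OF ballI])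
    then show ?thesis using u[of z] that by (simp add: upper_half_plane_def)
  qed
  then show ?thesis by blast
qed

end
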